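(* Let $\Omega\subset\mathbf{R}^d$ be a domain with boundary $\Gamma$ and let $\delta\ge0$. If the weighted boundary Hardy inequality $\|d_\Gamma^{\,\delta/2-1}\psi\|_2\le a\,\|d_\Gamma^{\,\delta/2}(\nabla\psi)\|_2$, for all $\psi\in C_c^1(\Gamma_r)$, is satisfied on $\Gamma_r$ (for all small $r>0$, with some $a>0$ depending on $r$), and if there is an Ahlfors point $x\in\Gamma$, with associated Hausdorff dimension $d_H$, then $$a_\delta(\Gamma)\ge \frac{2}{|(d-d_H)+\delta-2|}$$ for all $\delta\ge0$ with the exception of $\delta=2-(d-d_H)$.
   Context: $d_\Gamma(x)$ is the Euclidean distance from $x$ to the (non-empty) boundary $\Gamma$ of $\Omega$, $\Gamma_r=\{x\in\Omega: d_\Gamma(x)<r\}$, $\|\cdot\|_2$ is the $L_2$-norm, and $C_c^1(W)$ denotes the $C^1$-functions with compact support in the open set $W$. $a_\delta(\Gamma_r)$ is the infimum of the $a>0$ such that $\|d_\Gamma^{\,\delta/2-1}\psi\|_2\le a\,\|d_\Gamma^{\,\delta/2}(\nabla\psi)\|_2$ for all $\psi\in C_c^1(\Gamma_r)$, and $a_\delta(\Gamma)=\inf_{r>0}a_\delta(\Gamma_r)$. Ahlfors point: for a bounded subset $A\subset\Gamma$ let $A_r=\{y\in\overline\Omega: d(y;A)<r\}$, where $d(y;A)$ is the Euclidean distance from $y$ to $A$, and let $|A_r|$ be its Lebesgue measure. A point $x\in\Gamma$ is an Ahlfors point if for all small $s>0$ the set $A=\Gamma\cap B(x;s)$ ($B(x;s)$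 the open ball with centre $x$ and radius $s$) satisfies, with some $\kappa,\kappa'>0$, $$\kappa'\,r^{\,d-d_H}\le|A_r|\le\kappa\,r^{\,d-d_H}$$ for all small $r>0$, where $d_H$ is the Hausdorff dimension of $A$ (the same number for all small $s$). *)

theory Defs
  imports "HOL-Analysis.Analysis"
begin

abbreviation dist_bdry :: "'a::euclidean_space set \<Rightarrow> 'a \<Rightarrow> real" where
  "dist_bdry \<Omega> x \<equiv> infdist x (frontier \<Omega>)"

definition bdry_layer :: "'a::euclidean_space set \<Rightarrow> real \<Rightarrow> 'a set" where
  "bdry_layer \<Omega> r = {x \<in> \<Omega>. dist_bdry \<Omega> x < r}"

definition grad :: "('a::euclidean_space \<Rightarrow> real) \<Rightarrow> 'a \<Rightarrow> 'a" where
  "grad \<psi> x = (\<Sum>b\<in>Basis. frechet_derivative \<psi> (at x) b *\<^sub>R b)"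

text \<open>A compactly supported function on an open set \<open>W\<close> is represented by its extension by zero
  to the whole space.\<close>

definition C1_compact_support :: "'a::euclidean_space set \<Rightarrow> ('a \<Rightarrow> real) set" where
  "C1_compact_support W =
    {\<psi>. (\<forall>x. \<psi> differentiable (at x)) \<and> continuous_on UNIV (grad \<psi>) \<and>
        compact (closure {x. \<psi> x \<noteq> 0}) \<and> closure {x. \<psi> x \<noteq> 0} \<subseteq> W}"

text \<open>The Bochner integral of a non-integrable function is \<open>0\<close>. This does not matter here: the
  norm is only taken of functions that are continuous with compact support in the open set
  \<open>\<Omega>\<close>.\<close>

definition norm_L2 :: "'a::euclidean_space set \<Rightarrow> ('a \<Rightarrow> 'b::real_normed_vector) \<Rightarrow> real" where
  "norm_L2 \<Omega> f = sqrt (LINT x:\<Omega>|lborel. (norm (f x))\<^sup>2)"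

definition weighted_hardy :: "'a::euclidean_space set \<Rightarrow> real \<Rightarrow> real \<Rightarrow> real \<Rightarrow> bool" where
  "weighted_hardy \<Omega> \<delta> r a \<longleftrightarrow>
    (\<forall>\<psi> \<in> C1_compact_support (bdry_layer \<Omega> r).
       norm_L2 \<Omega> (\<lambda>x. dist_bdry \<Omega> x powr (\<delta> / 2 - 1) * \<psi> x)
         \<le> a * norm_L2 \<Omega> (\<lambda>x. dist_bdry \<Omega> x powr (\<delta> / 2) *\<^sub>R grad \<psi> x))"

text \<open>Extended reals, so that the infimum is \<open>\<infinity>\<close> when no constant is admissible.\<close>

definition hardy_const_layer :: "'a::euclidean_space set \<Rightarrow> real \<Rightarrow> real \<Rightarrow> ereal" where
  "hardy_const_layer \<Omega> \<delta> r = (INF a\<in>{a. a > 0 \<and> weighted_hardy \<Omega> \<delta> r a}. ereal a)"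

definition hardy_const_bdry :: "'a::euclidean_space set \<Rightarrow> real \<Rightarrow> ereal" where
  "hardy_const_bdry \<Omega> \<delta> = (INF r\<in>{0<..}. hardy_const_layer \<Omega> \<delta> r)"

text \<open>Hausdorff outer measure, up to the usual normalising factor. It is only meant for exponents
  \<open>s > 0\<close>, because \<open>0 powr 0 = 0\<close>. Boundedness is required because \<open>diameter\<close> is unspecified on
  unbounded sets.\<close>

definition hausdorff_content :: "real \<Rightarrow> real \<Rightarrow> 'a::metric_space set \<Rightarrow> ennreal" where
  "hausdorff_content s \<rho> A =
    (INF U\<in>{U :: nat \<Rightarrow> 'a set. A \<subseteq> (\<Union>i. U i) \<and> (\<forall>i. bounded (U i) \<and> diameter (U i) \<le> \<rho>)}.
       \<Sum>i. ennreal (diameter (U i) powr s))"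

definition hausdorff_measure :: "real \<Rightarrow> 'a::metric_space set \<Rightarrow> ennreal" where
  "hausdorff_measure s A = (SUP \<rho>\<in>{0<..}. hausdorff_content s \<rho> A)"

text \<open>In a Euclidean space every \<open>s > DIM('a)\<close> has Hausdorff measure \<open>0\<close>, so this is the infimum of
  a non-empty set of positive reals.\<close>

definition hausdorff_dim :: "'a::euclidean_space set \<Rightarrow> real" where
  "hausdorff_dim A = Inf {s. s > 0 \<and> hausdorff_measure s A = 0}"

definition inner_nbhd :: "'a::euclidean_space set \<Rightarrow> 'a set \<Rightarrow> real \<Rightarrow> 'a set" where
  "inner_nbhd \<Omega> A r = {y \<in> closure \<Omega>. infdist y A < r}"

text \<open>The constants \<open>\<kappa>\<close>, \<open>\<kappa>'\<close> and the range of \<open>r\<close> may depend on \<open>s\<close>; the dimension \<open>d\<^sub>H\<close> may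
  not.\<close>

definition ahlfors_point :: "'a::euclidean_space set \<Rightarrow> 'a \<Rightarrow> real \<Rightarrow> bool" where
  "ahlfors_point \<Omega> x d\<^sub>H \<longleftrightarrow> x \<in> frontier \<Omega> \<and>
    (\<forall>\<^sub>F s in at_right 0.
       hausdorff_dim (frontier \<Omega> \<inter> ball x s) = d\<^sub>H \<and>
       (\<exists>\<kappa>>0. \<exists>\<kappa>'>0. \<forall>\<^sub>F r in at_right 0.
          \<kappa>' * r powr (real DIM('a) - d\<^sub>H)
            \<le> measure lebesgue (inner_nbhd \<Omega> (frontier \<Omega> \<inter> ball x s) r) \<and>
          measure lebesgue (inner_nbhd \<Omega> (frontier \<Omega> \<inter> ball x s) r)
            \<le> \<kappa> * r powr (real DIM('a) - d\<^sub>H)))"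

end

theory Submission
  imports Defs
begin

text \<open>Write \<open>d\<close> for the distance to \<open>\<Gamma>\<close>, \<open>D\<close> for the codimension and \<open>\<lambda> = D + \<delta> - 2\<close>. Suppose the Hardy
  inequality holds on some layer with \<open>a \<bar>\<lambda>\<bar>/2 < 1\<close>. The test functions are \<open>d powr (-\<lambda>/2)\<close>, cut off
  where \<open>d < \<epsilon>\<close> and outside a ball; they become \<open>C\<^sup>1\<close> by replacing \<open>d\<close> by a smooth approximation with
  gradient at most \<open>1\<close>. The main term of the weighted gradient norm is \<open>\<bar>\<lambda>\<bar>/2\<close> times the left hand
  side and can be absorbed, so the integral of \<open>d powr -D\<close> over \<open>{d \<ge> 4\<epsilon>}\<close> in a ball is bounded by
  the contributions of the two cut-offs.

  If \<open>D > 0\<close>, the volume bounds at the Ahlfors point keep these contributions bounded as \<open>\<epsilon> \<rightarrow> 0\<close>,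
  while the integral diverges logarithmically. If \<open>D = 0\<close>, then \<open>\<Gamma>\<close> has positive Lebesgue measure near
  the point, the integral is just a volume and the Ahlfors point itself is useless as a centre.
  Instead, non-porosity of \<open>\<Gamma>\<close> yields points \<open>y\<close> of \<open>\<Omega>\<close> with \<open>d \<le> 2 d(y)\<close> on the ball of radius
  \<open>M d(y)\<close>, with \<open>M\<close> arbitrarily large; a radial cut-off at such a scale has negligible cost. The
  volume bounds exclude \<open>D < 0\<close>.\<close>

section \<open>Smooth cut-offs and the smoothed distance\<close>

lemma DERIV_max_zero_square:
  "((\<lambda>t::real. (max 0 t)\<^sup>2) has_real_derivative 2 * max 0 t) (at t)"
proof -
  consider "t > 0" | "t < 0" | "t = 0" by linarith
  then show ?thesis
  proof cases
    case 1
    have "((\<lambda>t::real. t\<^sup>2) has_real_derivative 2 * max 0 t) (at t)"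
      using 1 by (auto intro!: derivative_eq_intros)
    then show ?thesis
      by (rule has_field_derivative_transform_within_open[where S="{0<..}"]) (use 1 in auto)
  next
    case 2
    have "((\<lambda>t::real. 0) has_real_derivative 2 * max 0 t) (at t)"
      using 2 by (auto intro!: derivative_eq_intros)
    then show ?thesis
      by (rule has_field_derivative_transform_within_open[where S="{..<0}"]) (use 2 in auto)
  next
    case 3
    have "((\<lambda>h::real. (max 0 h)\<^sup>2 / h) \<longlongrightarrow> 0) (at 0)"
    proof (rule Lim_null_comparison)
      show "\<forall>\<^sub>F h in at (0::real). norm ((max 0 h)\<^sup>2 / h) \<le> \<bar>h\<bar>"
        by (rule always_eventually) (auto simp: max_def power2_eq_square)
      show "((\<lambda>h::real. \<bar>h\<bar>) \<longlongrightarrow> 0) (at 0)"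
        by (rule tendsto_rabs_zero) (rule tendsto_ident_at)
    qed
    then show ?thesis using 3 by (simp add: DERIV_def)
  qed
qed

text \<open>A quadratic spline. Its derivative is the tent that rises from 0 at \<open>0\<close> to
  2 at \<open>1/2\<close> and falls back to 0 at \<open>1\<close>; one continuous derivative is all
  that the test space requires.\<close>

definition smooth_step :: "real \<Rightarrow> real" where
  "smooth_step t = 2 * (max 0 t)\<^sup>2 - 4 * (max 0 (t - 1/2))\<^sup>2 + 2 * (max 0 (t - 1))\<^sup>2"

definition smooth_step' :: "real \<Rightarrow> real" where
  "smooth_step' t = 4 * max 0 t - 8 * max 0 (t - 1/2) + 4 * max 0 (t - 1)"

lemma DERIV_smooth_step: "(smooth_step has_real_derivative smooth_step' t) (at t)"
  unfolding smooth_step_def smooth_step'_def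
  by (rule derivative_eq_intros DERIV_max_zero_square[THEN DERIV_chain2] refl | simp)+

lemma continuous_on_smooth_step': "continuous_on A smooth_step'"
  unfolding smooth_step'_def by (intro continuous_intros)

lemma smooth_step_eq_0: "t \<le> 0 \<Longrightarrow> smooth_step t = 0"
  by (simp add: smooth_step_def)

lemma smooth_step_eq_1: "t \<ge> 1 \<Longrightarrow> smooth_step t = 1"
  by (simp add: smooth_step_def max_def power2_eq_square algebra_simps)

lemma smooth_step'_eq_0: "t \<le> 0 \<or> t \<ge> 1 \<Longrightarrow> smooth_step' t = 0"
  by (auto simp: smooth_step'_def max_def)

lemma abs_smooth_step'_le: "\<bar>smooth_step' t\<bar> \<le> 2"
  by (auto simp: smooth_step'_def max_def)

lemma smooth_step_bounds: "0 \<le> smooth_step t" "smooth_step t \<le> 1"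
proof -
  consider "t \<le> 0" | "0 < t" "t \<le> 1/2" | "1/2 < t" "t < 1" | "t \<ge> 1" by linarith
  then have "0 \<le> smooth_step t \<and> smooth_step t \<le> 1"
  proof cases
    case 2
    then have "t\<^sup>2 \<le> (1/2)\<^sup>2" by (intro power_mono) auto
    with 2 show ?thesis by (simp add: smooth_step_def power2_eq_square)
  next
    case 3
    have eq: "smooth_step t = 1 - 2 * (1 - t)\<^sup>2"
      using 3 by (simp add: smooth_step_def power2_eq_square algebra_simps)
    have "(1 - t)\<^sup>2 \<le> (1/2)\<^sup>2" using 3 by (intro power_mono) auto
    then show ?thesis unfolding eq by (simp add: power2_eq_square)
  qed (simp_all add: smooth_step_eq_0 smooth_step_eq_1)
  then show "0 \<le> smooth_step t" "smooth_step t \<le> 1" by auto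
qed

text \<open>The approximation is the soft minimum \<open>-(1/k) ln (\<Sum>p\<in>P. exp (-k |y - p|))\<close> over a finite
  net \<open>P\<close>: its gradient is a convex combination of the unit vectors \<open>sgn (y - p)\<close>.\<close>

lemma infdist_C1_approx:
  fixes S :: "'a::euclidean_space set" and c :: 'a
  assumes S: "closed S" "S \<noteq> {}" and h: "h > 0"
  obtains v :: "'a \<Rightarrow> real" and g :: "'a \<Rightarrow> 'a" where
    "\<And>y. y \<in> cball c R \<Longrightarrow> \<bar>v y - infdist y S\<bar> \<le> h"
    "\<And>y. y \<notin> S \<Longrightarrow> GDERIV v y :> g y"
    "\<And>y. y \<notin> S \<Longrightarrow> norm (g y) \<le> 1"
    "continuous_on (- S) g"
proof -
  \<comment> \<open>For \<open>y\<close> within \<open>\<bar>R\<bar>\<close> of \<open>c\<close>, a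
    nearest point of \<open>S\<close> has distance at most
    \<open>infdist c S + \<bar>R\<bar>\<close> from \<open>y\<close>, so it lies in this ball. The
    absolute value allows any sign of \<open>R\<close>.\<close>
  define K where "K = S \<inter> cball c (infdist c S + 2 * \<bar>R\<bar>)"
  have "compact K" unfolding K_def using S(1) by (simp add: closed_Int_compact)
  then obtain P where P: "finite P" "P \<subseteq> K" "K \<subseteq> (\<Union>p\<in>P. ball p (h/2))"
  proof (rule compactE_image[of K K "\<lambda>p. ball p (h/2)"])
    show "K \<subseteq> (\<Union>p\<in>K. ball p (h/2))" using h by auto
  qed auto
  have nearest: "\<exists>p\<in>K. dist y p = infdist y S" if "y \<in> cball c \<bar>R\<bar>" for y
  proof -
    obtain p where p: "p \<in> S" "infdist y S = dist y p"
      using infdist_attains_inf[OF S] by metis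
    have "dist c p \<le> dist c y + dist y p" by (rule dist_triangle)
    moreover have "infdist y S \<le> infdist c S + dist y c" by (rule infdist_triangle)
    ultimately have "p \<in> K" using p that by (auto simp: K_def dist_commute)
    with p show ?thesis by auto
  qed
  from nearest[of c] obtain q where "q \<in> K" by auto
  with P have "P \<noteq> {}" by auto
  define N where "N = real (card P)"
  have N: "N \<ge> 1" using P(1) \<open>P \<noteq> {}\<close> unfolding N_def
    by (metis One_nat_def Suc_leI card_gt_0_iff of_nat_1 of_nat_le_iff)
  \<comment> \<open>The soft minimum lies at most \<open>ln N / k\<close> below the true one, and
    this choice makes that at most \<open>h / 2\<close>. The added 1 keeps \<open>k\<close> positive
    when \<open>N = 1\<close>.\<close>
  define k where "k = 2 * (ln N + 1) / h"
  have lnN: "ln N \<ge> 0" using N by simp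
  have k: "k > 0" using h lnN by (simp add: k_def)
  have lnk: "ln N / k \<le> h / 2" using h lnN by (simp add: k_def field_simps)
  define w where "w p y = exp (- k * norm (y - p))" for p y :: 'a
  define F where "F y = (\<Sum>p\<in>P. w p y)" for y
  have w_pos: "w p y > 0" for p y by (simp add: w_def)
  have F_pos: "F y > 0" for y
    unfolding F_def using P(1) \<open>P \<noteq> {}\<close> w_pos by (intro sum_pos) auto
  define v where "v y = - ln (F y) / k" for y
  define g where "g y = (\<Sum>p\<in>P. (w p y / F y) *\<^sub>R sgn (y - p))" for y
  \<comment> \<open>Used twice: distances to net points are at least \<open>infdist y S\<close>, and
    the non-differentiable points of these distances all lie in \<open>S\<close>.\<close>
  have PS: "P \<subseteq> S" using P(2) by (auto simp: K_def)
  show thesis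
  proof
    fix y assume y: "y \<in> cball c R"
    have "y \<in> cball c \<bar>R\<bar>" using y by auto
    from nearest[OF this] obtain q where q: "q \<in> K" "dist y q = infdist y S" by auto
    with P(3) obtain p where p: "p \<in> P" "dist p q < h/2" by auto
    have "dist y p \<le> infdist y S + h/2"
      using dist_triangle[of y p q] p q by (simp add: dist_commute)
    moreover have "v y \<le> dist y p"
    proof -
      have "w p y \<le> F y" unfolding F_def
        by (rule member_le_sum) (use p P(1) w_pos in \<open>auto intro: less_imp_le\<close>)
      then have "ln (w p y) \<le> ln (F y)" using w_pos F_pos by simp
      then show ?thesis using k by (simp add: w_def v_def dist_norm field_simps)
    qed
    moreover have "infdist y S - h/2 \<le> v y"
    proof -
      have "F y \<le> (\<Sum>p\<in>P. exp (- k * infdist y S))" unfolding F_def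
      proof (rule sum_mono)
        fix p assume "p \<in> P"
        then have "infdist y S \<le> norm (y - p)"
          using PS infdist_le[of p S y] by (auto simp: dist_norm)
        then show "w p y \<le> exp (- k * infdist y S)" using k by (simp add: w_def)
      qed
      also have "\<dots> = N * exp (- k * infdist y S)" by (simp add: N_def)
      finally have "ln (F y) \<le> ln (N * exp (- k * infdist y S))"
        using F_pos N by (subst ln_le_cancel_iff) auto
      also have "\<dots> = ln N - k * infdist y S" using N by (simp add: ln_mult)
      finally have "(k * infdist y S - ln N) / k \<le> v y"
        unfolding v_def using k by (intro divide_right_mono) auto
      then have "infdist y S - ln N / k \<le> v y" using k by (simp add: diff_divide_distrib)
      then show ?thesis using lnk by linarith
    qed
    ultimately show "\<bar>v y - infdist y S\<bar> \<le> h" using h by linarith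
  next
    fix y assume y: "y \<notin> S"
    have w_deriv: "(w p has_derivative (\<lambda>z. z \<bullet> (- k * w p y) *\<^sub>R sgn (y - p))) (at y)"
      if "p \<in> P" for p
    proof -
      have "y - p \<noteq> 0" using that PS y by auto
      have "((\<lambda>y. y - p) has_derivative (\<lambda>z. z)) (at y)"
        by (auto intro!: derivative_eq_intros)
      then have "((\<lambda>y. norm (y - p)) has_derivative (\<lambda>z. z \<bullet> sgn (y - p))) (at y)"
        by (rule has_derivative_compose) (rule has_derivative_norm[OF \<open>y - p \<noteq> 0\<close>])
      then show ?thesis unfolding w_def
        by (auto intro!: derivative_eq_intros simp: algebra_simps)
    qed
    have "(F has_derivative (\<lambda>z. \<Sum>p\<in>P. z \<bullet> (- k * w p y) *\<^sub>R sgn (y - p))) (at y)"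
      unfolding F_def by (rule has_derivative_sum) (rule w_deriv)
    then have "(v has_derivative (\<lambda>z. - (inverse (F y) * (\<Sum>p\<in>P. z \<bullet> (- k * w p y) *\<^sub>R sgn (y - p))) / k)) (at y)"
      unfolding v_def using F_pos[of y] k
      by (auto intro!: derivative_eq_intros simp: field_simps)
    moreover have "- (inverse (F y) * (\<Sum>p\<in>P. z \<bullet> (- k * w p y) *\<^sub>R sgn (y - p))) / k = z \<bullet> g y" for z
      unfolding g_def inner_sum_right sum_distrib_left sum_negf[symmetric] sum_divide_distrib
      using k F_pos[of y] by (intro sum.cong) (auto simp: field_simps)
    ultimately show "GDERIV v y :> g y" by (simp add: gderiv_def)
    have "norm (g y) \<le> (\<Sum>p\<in>P. w p y / F y)" unfolding g_def
    proof (rule sum_norm_le)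
      fix p
      show "norm ((w p y / F y) *\<^sub>R sgn (y - p)) \<le> w p y / F y"
        using w_pos[of p y] F_pos[of y] by (auto simp: norm_sgn intro: less_imp_le)
    qed
    also have "\<dots> = 1" using F_pos[of y] by (simp add: F_def flip: sum_divide_distrib)
    finally show "norm (g y) \<le> 1" .
  next
    have "F y \<noteq> 0" for y using F_pos[of y] by simp
    moreover have "y - p \<noteq> 0" if "p \<in> P" "y \<in> - S" for y p using that PS by auto
    ultimately show "continuous_on (- S) g"
      unfolding g_def w_def F_def sgn_div_norm
      by (intro continuous_intros) (auto simp: F_def w_def)
  qed
qed

section \<open>Test functions\<close>

lemma grad_eq_GDERIV:
  assumes "GDERIV \<psi> x :> G"
  shows "grad \<psi> x = G"
proof -
  have "frechet_derivative \<psi> (at x) = (\<lambda>h. h \<bullet> G)"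
    using frechet_derivative_at[OF assms[unfolded gderiv_def]] by simp
  then show ?thesis
    unfolding grad_def by (simp add: inner_commute[of _ G] euclidean_representation)
qed

lemma C1_compact_supportI:
  assumes der: "\<And>x. GDERIV \<psi> x :> G x" and cont: "continuous_on UNIV G"
    and K: "compact K" "K \<subseteq> W" "\<And>x. x \<notin> K \<Longrightarrow> \<psi> x = 0"
  shows "\<psi> \<in> C1_compact_support W"
proof -
  have "grad \<psi> = G" using grad_eq_GDERIV[OF der] by auto
  moreover have "closure {x. \<psi> x \<noteq> 0} \<subseteq> K"
    by (rule closure_minimal) (use K compact_imp_closed in auto)
  moreover from this have "compact (closure {x. \<psi> x \<noteq> 0})"
    using K(1) by (metis closed_closure compact_Int_closed inf.absorb_iff2)
  ultimately show ?thesis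
    using der cont K(2) unfolding C1_compact_support_def gderiv_def differentiable_def by blast
qed

text \<open>The shift by 1 makes the function vanish for \<open>t \<le> \<epsilon>\<close> and equal
  \<open>t powr b\<close> for \<open>t \<ge> 2 * \<epsilon>\<close>, so the singularity of a
  negative power at 0 never appears.\<close>

definition cutoff_powr :: "real \<Rightarrow> real \<Rightarrow> real \<Rightarrow> real" where
  "cutoff_powr \<epsilon> b t = t powr b * smooth_step (t / \<epsilon> - 1)"

definition cutoff_powr' :: "real \<Rightarrow> real \<Rightarrow> real \<Rightarrow> real" where
  "cutoff_powr' \<epsilon> b t = b * t powr (b - 1) * smooth_step (t / \<epsilon> - 1) + t powr b * smooth_step' (t / \<epsilon> - 1) / \<epsilon>"

lemma cutoff_powr_eq_0:
  assumes "\<epsilon> > 0" "t \<le> \<epsilon>"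
  shows "cutoff_powr \<epsilon> b t = 0" "cutoff_powr' \<epsilon> b t = 0"
  using assms by (simp_all add: cutoff_powr_def cutoff_powr'_def smooth_step_eq_0 smooth_step'_eq_0)

lemma DERIV_cutoff_powr:
  assumes "\<epsilon> > 0"
  shows "(cutoff_powr \<epsilon> b has_real_derivative cutoff_powr' \<epsilon> b t) (at t)"
\<comment> \<open>The point \<open>t = \<epsilon>\<close> belongs to the second case, where
  \<open>t > 0\<close> and the defining formula itself is differentiable.\<close>
proof (cases "t < \<epsilon>")
  case True
  have "((\<lambda>t. 0) has_real_derivative cutoff_powr' \<epsilon> b t) (at t)"
    using True assms by (simp add: cutoff_powr_eq_0)
  then show ?thesis
    by (rule has_field_derivative_transform_within_open[where S="{..<\<epsilon>}"])
      (use True assms in \<open>auto simp: cutoff_powr_eq_0\<close>)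
next
  case False
  then have "t > 0" using assms by simp
  then show ?thesis
    unfolding cutoff_powr_def [abs_def] cutoff_powr'_def using assms
    by (auto intro!: derivative_eq_intros DERIV_smooth_step[THEN DERIV_chain2] simp: field_simps)
qed

lemma continuous_on_cutoff_powr':
  assumes "\<epsilon> > 0"
  shows "continuous_on UNIV (cutoff_powr' \<epsilon> b)"
proof -
  have "continuous_on {..<\<epsilon>} (cutoff_powr' \<epsilon> b)"
    by (rule continuous_on_eq[of _ "\<lambda>t. 0"]) (use assms in \<open>auto simp: cutoff_powr_eq_0\<close>)
  moreover have "continuous_on UNIV smooth_step"
    using DERIV_isCont[OF DERIV_smooth_step] by (intro continuous_at_imp_continuous_on) blast
  then have "continuous_on {0<..} (cutoff_powr' \<epsilon> b)"
    unfolding cutoff_powr'_def using assms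
    by (intro continuous_intros continuous_on_compose2[OF \<open>continuous_on UNIV smooth_step\<close>]
        continuous_on_compose2[OF continuous_on_smooth_step'[of UNIV]]) auto
  \<comment> \<open>Two overlapping open half-lines: on one the function is zero, on the other all
    powers are continuous.\<close>
  ultimately have "continuous_on ({..<\<epsilon>} \<union> {0<..}) (cutoff_powr' \<epsilon> b)"
    by (intro continuous_on_open_Un) auto
  moreover have "{..<\<epsilon>} \<union> {0<..} = (UNIV :: real set)" using assms by auto
  ultimately show ?thesis by simp
qed

text \<open>The squared distance from \<open>c\<close> is used because it is smooth at
  \<open>c\<close> as well. For \<open>0 < R1 < R2\<close> the cut-off is 1 on the ball of radius
  \<open>R1\<close> and 0 outside the ball of radius \<open>R2\<close>.\<close>

definition radial_cutoff :: "'a::euclidean_space \<Rightarrow> real \<Rightarrow> real \<Rightarrow> 'a \<Rightarrow> real" where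
  "radial_cutoff c R1 R2 y = smooth_step ((R2\<^sup>2 - (y - c) \<bullet> (y - c)) / (R2\<^sup>2 - R1\<^sup>2))"

definition radial_cutoff' :: "'a::euclidean_space \<Rightarrow> real \<Rightarrow> real \<Rightarrow> 'a \<Rightarrow> 'a" where
  "radial_cutoff' c R1 R2 y =
    (- 2 * smooth_step' ((R2\<^sup>2 - (y - c) \<bullet> (y - c)) / (R2\<^sup>2 - R1\<^sup>2)) / (R2\<^sup>2 - R1\<^sup>2)) *\<^sub>R (y - c)"

context
  fixes c :: "'a::euclidean_space" and R1 R2 :: real
  assumes R: "0 < R1" "R1 < R2"
begin

lemma radii_square_less: "R1\<^sup>2 < R2\<^sup>2"
  using R by (intro power_strict_mono) auto

lemma GDERIV_radial_cutoff: "GDERIV (radial_cutoff c R1 R2) y :> radial_cutoff' c R1 R2 y"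
proof -
  have "((\<lambda>y. R2\<^sup>2 - (y - c) \<bullet> (y - c)) has_derivative (\<lambda>h. - 2 * (h \<bullet> (y - c)))) (at y)"
    by (auto intro!: derivative_eq_intros simp: inner_commute)
  from has_derivative_mult_right[OF this, of "inverse (R2\<^sup>2 - R1\<^sup>2)"]
  have "((\<lambda>y. (R2\<^sup>2 - (y - c) \<bullet> (y - c)) / (R2\<^sup>2 - R1\<^sup>2)) has_derivative
      (\<lambda>h. - 2 * (h \<bullet> (y - c)) / (R2\<^sup>2 - R1\<^sup>2))) (at y)"
    by (simp add: divide_inverse mult.commute)
  from DERIV_compose_FDERIV[OF DERIV_smooth_step this] show ?thesis
    unfolding radial_cutoff_def[abs_def] radial_cutoff'_def gderiv_def
    by (rule has_derivative_eq_rhs) auto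
qed

lemma continuous_on_radial_cutoff': "continuous_on UNIV (radial_cutoff' c R1 R2)"
  unfolding radial_cutoff'_def using radii_square_less
  by (intro continuous_intros continuous_on_compose2[OF continuous_on_smooth_step'[of UNIV]]) auto

lemma radial_cutoff_bounds: "0 \<le> radial_cutoff c R1 R2 y" "radial_cutoff c R1 R2 y \<le> 1"
  by (simp_all add: radial_cutoff_def smooth_step_bounds)

lemma radial_cutoff_eq_1: "y \<in> ball c R1 \<Longrightarrow> radial_cutoff c R1 R2 y = 1"
  unfolding radial_cutoff_def
proof (rule smooth_step_eq_1)
  assume "y \<in> ball c R1"
  then have "(norm (y - c))\<^sup>2 \<le> R1\<^sup>2" by (intro power_mono) (auto simp: dist_norm norm_minus_commute)
  then show "1 \<le> (R2\<^sup>2 - (y - c) \<bullet> (y - c)) / (R2\<^sup>2 - R1\<^sup>2)"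
    using radii_square_less by (simp add: power2_norm_eq_inner)
qed

lemma radial_cutoff_eq_0:
  assumes "y \<notin> ball c R2"
  shows "radial_cutoff c R1 R2 y = 0" "radial_cutoff' c R1 R2 y = 0"
proof -
  have "R2\<^sup>2 \<le> (norm (y - c))\<^sup>2"
    using assms R by (intro power_mono) (auto simp: dist_norm norm_minus_commute)
  then have "(R2\<^sup>2 - (y - c) \<bullet> (y - c)) / (R2\<^sup>2 - R1\<^sup>2) \<le> 0"
    using radii_square_less by (simp add: power2_norm_eq_inner divide_le_0_iff)
  then show "radial_cutoff c R1 R2 y = 0" "radial_cutoff' c R1 R2 y = 0"
    by (simp_all add: radial_cutoff_def radial_cutoff'_def smooth_step_eq_0 smooth_step'_eq_0)
qed

text \<open>Factoring \<open>R2^2 - R1^2\<close> as \<open>(R2 - R1) * (R2 + R1)\<close> cancels the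
  factor \<open>norm (y - c)\<close>, which is at most \<open>R2 + R1\<close> on the
  support.\<close>

lemma norm_radial_cutoff'_le: "norm (radial_cutoff' c R1 R2 y) \<le> 4 / (R2 - R1)"
proof (cases "y \<in> ball c R2")
  case True
  then have n: "norm (y - c) \<le> R2 + R1" using R by (auto simp: dist_norm norm_minus_commute)
  define s where "s = smooth_step' ((R2\<^sup>2 - (y - c) \<bullet> (y - c)) / (R2\<^sup>2 - R1\<^sup>2))"
  have s: "\<bar>s\<bar> \<le> 2" unfolding s_def by (rule abs_smooth_step'_le)
  have sq: "R2\<^sup>2 - R1\<^sup>2 = (R2 - R1) * (R2 + R1)" by (simp add: power2_eq_square algebra_simps)
  have "norm (radial_cutoff' c R1 R2 y) = (2 * \<bar>s\<bar> * norm (y - c)) / (R2\<^sup>2 - R1\<^sup>2)"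
    using radii_square_less by (simp add: radial_cutoff'_def s_def abs_mult)
  also have "\<dots> \<le> (2 * 2 * (R2 + R1)) / (R2\<^sup>2 - R1\<^sup>2)"
    using radii_square_less s n R by (intro divide_right_mono mult_mono) auto
  also have "\<dots> = 4 / (R2 - R1)" unfolding sq using mult_divide_mult_cancel_right[of "R2 + R1" 4 "R2 - R1"] R by simp
  finally show ?thesis .
qed (use R in \<open>simp add: radial_cutoff_eq_0\<close>)

end

text \<open>The function is \<open>cutoff_powr \<epsilon> b\<close> of the smoothed distance times
  the radial cut-off, extended by zero. The value \<open>t\<close> is the smoothed distance at
  \<open>y\<close>. The three terms of the gradient bound come from the power, from the cut-off near
  the boundary and from the radial cut-off.\<close>

lemma hardy_test_function:
  fixes \<Omega> :: "'a::euclidean_space set"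
  assumes \<Omega>: "open \<Omega>" "frontier \<Omega> \<noteq> {}" and R: "0 < R1" "R1 < R2"
    and h: "0 < h" "h \<le> \<epsilon> / 2"
    and layer: "\<And>y. y \<in> \<Omega> \<inter> cball c R2 \<Longrightarrow> dist_bdry \<Omega> y < r"
  obtains \<psi> where
    "\<psi> \<in> C1_compact_support (bdry_layer \<Omega> r)"
    "\<And>y. \<psi> y \<noteq> 0 \<or> grad \<psi> y \<noteq> 0 \<Longrightarrow> y \<in> \<Omega> \<inter> ball c R2 \<and>
      (\<exists>t>\<epsilon>. \<bar>t - dist_bdry \<Omega> y\<bar> \<le> h \<and>
        norm (grad \<psi> y) \<le> \<bar>b\<bar> * \<bar>\<psi> y\<bar> / t + (if t < 2 * \<epsilon> then 2 / \<epsilon> * t powr b else 0)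
          + 4 / (R2 - R1) * t powr b)"
    "\<And>y. y \<in> \<Omega> \<inter> ball c R1 \<Longrightarrow> 4 * \<epsilon> \<le> dist_bdry \<Omega> y \<Longrightarrow>
      \<exists>t. \<bar>t - dist_bdry \<Omega> y\<bar> \<le> h \<and> \<psi> y = t powr b"
proof -
  define d where "d = dist_bdry \<Omega>"
  have \<epsilon>: "\<epsilon> > 0" using h by simp
  obtain v g where vg: "\<And>y. y \<in> cball c R2 \<Longrightarrow> \<bar>v y - d y\<bar> \<le> h"
    "\<And>y. y \<notin> frontier \<Omega> \<Longrightarrow> GDERIV v y :> g y"
    "\<And>y. y \<notin> frontier \<Omega> \<Longrightarrow> norm (g y) \<le> 1" "continuous_on (- frontier \<Omega>) g"
    unfolding d_def using infdist_C1_approx[OF frontier_closed \<Omega>(2) h(1), of c R2] by blast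
  define \<phi> where "\<phi> = radial_cutoff c R1 R2"
  define \<phi>' where "\<phi>' = radial_cutoff' c R1 R2"
  define \<psi> where "\<psi> y = (if y \<in> \<Omega> then cutoff_powr \<epsilon> b (v y) * \<phi> y else 0)" for y
  define G where "G y = (if y \<in> \<Omega> then (cutoff_powr' \<epsilon> b (v y) * \<phi> y) *\<^sub>R g y
      + cutoff_powr \<epsilon> b (v y) *\<^sub>R \<phi>' y else 0)" for y
  \<comment> \<open>A compact set carrying the support: where \<open>d y < \<epsilon> / 2\<close>,
    the error \<open>h \<le> \<epsilon> / 2\<close> still leaves the smoothed distance below
    \<open>\<epsilon>\<close>. Positive distance keeps \<open>K\<close> off the boundary, hence
    inside \<open>\<Omega>\<close>.\<close>
  define K where "K = {y \<in> closure \<Omega> \<inter> cball c R2. \<epsilon> / 2 \<le> d y}"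
  have zero: "\<psi> y = 0 \<and> G y = 0" if "y \<notin> \<Omega> \<or> y \<notin> ball c R2 \<or> v y \<le> \<epsilon>" for y
    using that \<epsilon> radial_cutoff_eq_0[OF R, of y c]
    by (auto simp: \<psi>_def G_def cutoff_powr_eq_0 \<phi>_def \<phi>'_def)
  have zeroK: "\<psi> y = 0 \<and> G y = 0" if "y \<notin> K" for y
  proof (rule zero)
    have "v y \<le> \<epsilon>" if "y \<in> \<Omega>" "y \<in> ball c R2"
      using vg(1)[of y] that \<open>y \<notin> K\<close> h closure_subset[of \<Omega>] by (auto simp: K_def)
    then show "y \<notin> \<Omega> \<or> y \<notin> ball c R2 \<or> v y \<le> \<epsilon>" by blast
  qed
  have cont_d: "continuous_on UNIV d" unfolding d_def by (intro continuous_intros)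
  have "closed K"
  proof -
    have "closed {y. \<epsilon> / 2 \<le> d y}"
      using cont_d by (intro closed_Collect_le continuous_intros)
    moreover have "K = (closure \<Omega> \<inter> cball c R2) \<inter> {y. \<epsilon> / 2 \<le> d y}" by (auto simp: K_def)
    ultimately show ?thesis by auto
  qed
  moreover have "bounded K"
    by (rule bounded_subset[of "cball c R2"]) (auto simp: K_def)
  ultimately have "compact K" by (simp add: compact_eq_bounded_closed)
  have K\<Omega>: "K \<subseteq> \<Omega>"
  proof
    fix y assume "y \<in> K"
    then have "y \<in> closure \<Omega>" "d y \<noteq> 0" using \<epsilon> by (auto simp: K_def)
    then have "y \<notin> frontier \<Omega>" unfolding d_def by auto
    with \<open>y \<in> closure \<Omega>\<close> \<open>open \<Omega>\<close> show "y \<in> \<Omega>" by (simp add: frontier_def interior_open)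
  qed
  have "open (- K)" using \<open>closed K\<close> by auto
  have un: "\<Omega> \<union> (- K) = UNIV" using K\<Omega> by auto
  have not_fr: "y \<notin> frontier \<Omega>" if "y \<in> \<Omega>" for y
    using that \<open>open \<Omega>\<close> by (simp add: frontier_def interior_open)
  \<comment> \<open>The open sets \<open>\<Omega>\<close> and \<open>- K\<close> cover the space. On
    the first the product formula holds, on the second the function vanishes; continuity of
    \<open>G\<close> is glued in the same way.\<close>
  have der: "GDERIV \<psi> y :> G y" for y
  proof (cases "y \<in> \<Omega>")
    case True
    have "GDERIV (\<lambda>y. cutoff_powr \<epsilon> b (v y)) y :> cutoff_powr' \<epsilon> b (v y) *\<^sub>R g y"
      by (rule GDERIV_DERIV_compose[OF vg(2)[OF not_fr[OF True]] DERIV_cutoff_powr[OF \<epsilon>]])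
    from GDERIV_mult[OF this GDERIV_radial_cutoff[OF R]]
    have "GDERIV (\<lambda>y. cutoff_powr \<epsilon> b (v y) * \<phi> y) y :> G y"
      using True by (simp add: \<phi>_def \<phi>'_def G_def algebra_simps)
    then show ?thesis unfolding gderiv_def
      by (rule has_derivative_transform_within_open[OF _ \<open>open \<Omega>\<close> True]) (simp add: \<psi>_def)
  next
    case False
    with K\<Omega> have "y \<in> - K" by auto
    have "GDERIV (\<lambda>y. 0) y :> G y"
      using zeroK[of y] \<open>y \<in> - K\<close> by (auto simp: gderiv_def)
    then show ?thesis unfolding gderiv_def
      by (rule has_derivative_transform_within_open[OF _ \<open>open (- K)\<close> \<open>y \<in> - K\<close>])
        (use zeroK in auto)
  qed
  have G_eq: "grad \<psi> y = G y" for y by (rule grad_eq_GDERIV[OF der])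
  have "continuous_on UNIV G"
  proof -
    have cv: "continuous_on \<Omega> v"
      using vg(2) not_fr unfolding gderiv_def
      by (intro has_derivative_continuous_on) (blast intro: has_derivative_at_withinI)
    have cg: "continuous_on \<Omega> g"
      by (rule continuous_on_subset[OF vg(4)]) (use not_fr in auto)
    have cf: "continuous_on UNIV (cutoff_powr \<epsilon> b)"
      using DERIV_isCont[OF DERIV_cutoff_powr[OF \<epsilon>]]
      by (intro continuous_at_imp_continuous_on) blast
    have c\<phi>: "continuous_on \<Omega> \<phi>"
      using GDERIV_radial_cutoff[OF R] unfolding gderiv_def \<phi>_def
      by (intro has_derivative_continuous_on) (blast intro: has_derivative_at_withinI)
    have c\<phi>': "continuous_on \<Omega> \<phi>'"
      unfolding \<phi>'_def using continuous_on_radial_cutoff'[OF R] continuous_on_subset by blast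
    have "continuous_on \<Omega> (\<lambda>y. (cutoff_powr' \<epsilon> b (v y) * \<phi> y) *\<^sub>R g y
      + cutoff_powr \<epsilon> b (v y) *\<^sub>R \<phi>' y)"
      by (intro continuous_intros cg c\<phi> c\<phi>' continuous_on_compose2[OF cf cv]
          continuous_on_compose2[OF continuous_on_cutoff_powr'[OF \<epsilon>] cv]) auto
    then have "continuous_on \<Omega> G" by (simp add: G_def cong: continuous_on_cong)
    moreover have "continuous_on (- K) G"
      by (rule continuous_on_eq[of _ "\<lambda>y. 0"]) (use zeroK in auto)
    ultimately have "continuous_on (\<Omega> \<union> (- K)) G"
      using \<open>open \<Omega>\<close> \<open>open (- K)\<close> by (intro continuous_on_open_Un) auto
    then show ?thesis by (simp only: un)
  qed
  show thesis
  proof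
    have "K \<subseteq> bdry_layer \<Omega> r" using K\<Omega> layer by (auto simp: bdry_layer_def K_def)
    then show "\<psi> \<in> C1_compact_support (bdry_layer \<Omega> r)"
      using zeroK by (intro C1_compact_supportI[OF der \<open>continuous_on UNIV G\<close> \<open>compact K\<close>]) auto
  next
    fix y assume "\<psi> y \<noteq> 0 \<or> grad \<psi> y \<noteq> 0"
    then have "\<not> (y \<notin> \<Omega> \<or> y \<notin> ball c R2 \<or> v y \<le> \<epsilon>)" using zero[of y] G_eq[of y] by metis
    then have y: "y \<in> \<Omega>" "y \<in> ball c R2" "v y > \<epsilon>" by auto
    define t where "t = v y"
    have t: "t > 0" using y \<epsilon> by (simp add: t_def)
    have "\<bar>t - d y\<bar> \<le> h" using vg(1)[of y] y by (simp add: t_def)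
    have \<phi>1: "0 \<le> \<phi> y" "\<phi> y \<le> 1" by (simp_all add: \<phi>_def radial_cutoff_bounds[OF R])
    define s where "s = smooth_step' (t / \<epsilon> - 1)"
    have "\<bar>s\<bar> \<le> (if t < 2 * \<epsilon> then 2 else 0)"
      using abs_smooth_step'_le smooth_step'_eq_0[of "t / \<epsilon> - 1"] \<epsilon> by (auto simp: s_def field_simps)
    have "G y = (cutoff_powr' \<epsilon> b t * \<phi> y) *\<^sub>R g y + cutoff_powr \<epsilon> b t *\<^sub>R \<phi>' y"
      using y by (simp add: G_def t_def)
    then have "norm (G y) \<le> \<bar>cutoff_powr' \<epsilon> b t * \<phi> y\<bar> * norm (g y) + \<bar>cutoff_powr \<epsilon> b t\<bar> * norm (\<phi>' y)"
      using norm_triangle_ineq[of "(cutoff_powr' \<epsilon> b t * \<phi> y) *\<^sub>R g y" "cutoff_powr \<epsilon> b t *\<^sub>R \<phi>' y"] by simp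
    \<comment> \<open>The gradient bound 1 of the smoothed distance enters here; a larger bound
      would spoil the sharp coefficient \<open>\<bar>b\<bar>\<close> of the main term.\<close>
    moreover have "\<bar>cutoff_powr' \<epsilon> b t * \<phi> y\<bar> * norm (g y) \<le> \<bar>cutoff_powr' \<epsilon> b t * \<phi> y\<bar> * 1"
      by (intro mult_left_mono vg(3) not_fr y) auto
    moreover have "\<bar>cutoff_powr \<epsilon> b t\<bar> * norm (\<phi>' y) \<le> \<bar>cutoff_powr \<epsilon> b t\<bar> * (4 / (R2 - R1))"
      unfolding \<phi>'_def by (intro mult_left_mono norm_radial_cutoff'_le[OF R]) auto
    moreover have "\<bar>cutoff_powr' \<epsilon> b t * \<phi> y\<bar> * 1
        \<le> \<bar>b\<bar> * \<bar>\<psi> y\<bar> / t + (if t < 2 * \<epsilon> then 2 / \<epsilon> * t powr b else 0)"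
    proof -
      have "cutoff_powr' \<epsilon> b t * \<phi> y = b * \<psi> y / t + (s / \<epsilon> * t powr b) * \<phi> y"
        using y t by (simp add: cutoff_powr'_def \<psi>_def cutoff_powr_def t_def[symmetric] s_def
            powr_diff algebra_simps)
      then have "\<bar>cutoff_powr' \<epsilon> b t * \<phi> y\<bar> * 1 \<le> \<bar>b * \<psi> y / t\<bar> + \<bar>(s / \<epsilon> * t powr b) * \<phi> y\<bar>"
        unfolding mult_1_right by (simp only: abs_triangle_ineq)
      also have "\<bar>(s / \<epsilon> * t powr b) * \<phi> y\<bar> \<le> (\<bar>s\<bar> / \<epsilon> * t powr b) * 1"
        unfolding abs_mult using \<phi>1 \<epsilon> by (intro mult_mono) auto
      also have "(\<bar>s\<bar> / \<epsilon> * t powr b) * 1 \<le> (if t < 2 * \<epsilon> then 2 / \<epsilon> * t powr b else 0)"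
        using \<open>\<bar>s\<bar> \<le> _\<close> \<epsilon> by (auto intro!: mult_right_mono divide_right_mono split: if_splits)
      also have "\<bar>b * \<psi> y / t\<bar> = \<bar>b\<bar> * \<bar>\<psi> y\<bar> / t" using t by (simp add: abs_mult)
      finally show ?thesis by simp
    qed
    moreover have "\<bar>cutoff_powr \<epsilon> b t\<bar> * (4 / (R2 - R1)) \<le> 4 / (R2 - R1) * t powr b"
    proof -
      have "\<bar>cutoff_powr \<epsilon> b t\<bar> \<le> t powr b"
        using smooth_step_bounds[of "t / \<epsilon> - 1"] by (simp add: cutoff_powr_def abs_mult mult_left_le)
      then have "\<bar>cutoff_powr \<epsilon> b t\<bar> * (4 / (R2 - R1)) \<le> t powr b * (4 / (R2 - R1))"
        by (rule mult_right_mono) (use R in auto)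
      then show ?thesis by (simp only: mult.commute)
    qed
    ultimately have "norm (grad \<psi> y) \<le> \<bar>b\<bar> * \<bar>\<psi> y\<bar> / t + (if t < 2 * \<epsilon> then 2 / \<epsilon> * t powr b else 0)
          + 4 / (R2 - R1) * t powr b" unfolding G_eq by linarith
    then show "y \<in> \<Omega> \<inter> ball c R2 \<and>
      (\<exists>t>\<epsilon>. \<bar>t - dist_bdry \<Omega> y\<bar> \<le> h \<and>
        norm (grad \<psi> y) \<le> \<bar>b\<bar> * \<bar>\<psi> y\<bar> / t + (if t < 2 * \<epsilon> then 2 / \<epsilon> * t powr b else 0)
          + 4 / (R2 - R1) * t powr b)"
      using y \<open>\<bar>t - d y\<bar> \<le> h\<close> unfolding t_def d_def by blast
  next
    fix y assume y: "y \<in> \<Omega> \<inter> ball c R1" "4 * \<epsilon> \<le> dist_bdry \<Omega> y"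
    have v: "\<bar>v y - d y\<bar> \<le> h" using vg(1)[of y] y R by auto
    then have "v y \<ge> 2 * \<epsilon>" using y(2) h \<epsilon> unfolding d_def by linarith
    then have "smooth_step (v y / \<epsilon> - 1) = 1" using \<epsilon> by (intro smooth_step_eq_1) (simp add: field_simps)
    moreover have "\<phi> y = 1" unfolding \<phi>_def using y by (intro radial_cutoff_eq_1[OF R]) auto
    ultimately have "\<psi> y = v y powr b" using y by (simp add: \<psi>_def cutoff_powr_def)
    with v show "\<exists>t. \<bar>t - dist_bdry \<Omega> y\<bar> \<le> h \<and> \<psi> y = t powr b" unfolding d_def by blast
  qed
qed

section \<open>A Caccioppoli inequality\<close>

lemma powr_square: "(x powr e)\<^sup>2 = x powr (2 * e)" for x e :: real
  by (simp add: power2_eq_square flip: powr_add)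

text \<open>The power is increasing or decreasing according to the sign of \<open>e\<close>; each of
  the two comparability assumptions serves one sign.\<close>

lemma powr_le_comparable:
  fixes t d e :: real
  assumes "0 < t" "0 < d" "t \<le> 2 * d" "d \<le> 2 * t"
  shows "t powr e \<le> 2 powr \<bar>e\<bar> * d powr e"
proof (cases "e \<ge> 0")
  case True
  have "t powr e \<le> (2 * d) powr e" using assms True by (intro powr_mono2) auto
  then show ?thesis using assms True by (simp add: powr_mult)
next
  case False
  have "t powr e \<le> (d / 2) powr e" using assms False by (intro powr_mono2') auto
  also have "\<dots> = 2 powr (- e) * d powr e" using assms
    by (simp add: powr_divide powr_minus field_simps)
  finally show ?thesis using False by simp
qed

text \<open>Young's inequality with parameter \<eta> keeps the coefficient of the main term close to
  \<open>b^2\<close> and charges \<open>1 + 1 / \<eta>\<close> to the cut-off terms. Of the three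
  factors \<open>1 + \<eta>\<close>, one comes from Young's inequality and two from the estimate of
  \<open>(d / t)^2\<close>.\<close>

lemma hardy_pointwise:
  fixes t d \<epsilon> \<eta> p n b \<delta> k :: real
  assumes \<epsilon>: "0 < \<epsilon>" "\<epsilon> < t" and \<eta>: "0 < \<eta>" "\<eta> \<le> 1/2" and td: "\<bar>t - d\<bar> \<le> \<eta> * \<epsilon>"
    and "0 \<le> p" "0 \<le> k" "0 \<le> n"
    and n: "n \<le> \<bar>b\<bar> * p / t + (if t < 2 * \<epsilon> then 2 / \<epsilon> * t powr b else 0) + k * t powr b"
  shows "d powr \<delta> * n\<^sup>2 \<le> (1 + \<eta>) ^ 3 * b\<^sup>2 * (d powr (\<delta> - 2) * p\<^sup>2)
      + 2 * (1 + 1 / \<eta>) * 2 powr (2 * \<bar>b\<bar>) *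
        (36 * (if d \<le> 4 * \<epsilon> then d powr (\<delta> + 2 * b - 2) else 0) + k\<^sup>2 * d powr (\<delta> + 2 * b))"
proof -
  define s where "s = (if t < 2 * \<epsilon> then 2 / \<epsilon> * t powr b else 0)"
  define q where "q = k * t powr b"
  define A where "A = \<bar>b\<bar> * p / t"
  have e\<eta>: "\<eta> * \<epsilon> \<le> \<epsilon> / 2" using mult_right_mono[of \<eta> "1/2" \<epsilon>] \<eta> \<epsilon> by simp
  have e\<eta>t: "\<eta> * \<epsilon> \<le> \<eta> * t" using \<eta> \<epsilon> by (intro mult_left_mono) auto
  have d: "d > 0" "d \<le> (1 + \<eta>) * t" "t \<le> 2 * d" "d \<le> 2 * t"
    using td e\<eta> e\<eta>t \<epsilon> unfolding distrib_right mult_1_left by linarith+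
  have t: "t > 0" using \<epsilon> by linarith
  have pos: "A \<ge> 0" "s \<ge> 0" "q \<ge> 0" using assms t by (auto simp: A_def s_def q_def)
  have tb: "(t powr b)\<^sup>2 \<le> 2 powr (2 * \<bar>b\<bar>) * d powr (2 * b)"
    using powr_le_comparable[OF t d(1) d(3,4), of "2 * b"] by (simp add: powr_square abs_mult)
  have d2: "d powr \<delta> = d powr (\<delta> - 2) * d\<^sup>2"
    using d(1) by (simp add: powr_diff)
  have alg: "(1 + \<eta>) * ((1 + \<eta>)\<^sup>2 * B * P) + K * (T * Z1 + T * Z2) = (1 + \<eta>) ^ 3 * B * P + K * T * (Z1 + Z2)"
    for B P K T Z1 Z2 :: real
    by (simp add: power2_eq_square power3_eq_cube algebra_simps)
  have "n\<^sup>2 \<le> (A + (s + q))\<^sup>2"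
    using n \<open>0 \<le> n\<close> by (intro power_mono) (simp_all add: A_def s_def q_def)
  also have "\<dots> \<le> (1 + \<eta>) * A\<^sup>2 + (1 + 1 / \<eta>) * (s + q)\<^sup>2"
  proof -
    have "0 \<le> (\<eta> * A - (s + q))\<^sup>2 / \<eta>" using \<eta> by simp
    also have "\<dots> = \<eta> * A\<^sup>2 - 2 * A * (s + q) + (s + q)\<^sup>2 / \<eta>"
      using \<eta> by (simp add: power2_eq_square field_simps)
    finally have "2 * A * (s + q) \<le> \<eta> * A\<^sup>2 + (s + q)\<^sup>2 / \<eta>" by simp
    moreover have "(A + (s + q))\<^sup>2 = A\<^sup>2 + 2 * A * (s + q) + (s + q)\<^sup>2" by (rule power2_sum[THEN trans]) simp
    ultimately show ?thesis by (simp add: distrib_right)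
  qed
  also have "\<dots> \<le> (1 + \<eta>) * A\<^sup>2 + (1 + 1 / \<eta>) * (2 * s\<^sup>2 + 2 * q\<^sup>2)"
  proof -
    have "0 \<le> (s - q)\<^sup>2" by simp
    then have "(s + q)\<^sup>2 \<le> 2 * s\<^sup>2 + 2 * q\<^sup>2" by (simp add: power2_eq_square algebra_simps)
    then show ?thesis using \<eta> by (intro add_left_mono mult_left_mono) auto
  qed
  finally have "d powr \<delta> * n\<^sup>2 \<le> d powr \<delta> * ((1 + \<eta>) * A\<^sup>2 + (1 + 1 / \<eta>) * (2 * s\<^sup>2 + 2 * q\<^sup>2))"
    by (intro mult_left_mono) auto
  also have "\<dots> = (1 + \<eta>) * (d powr \<delta> * A\<^sup>2) + 2 * (1 + 1 / \<eta>) * (d powr \<delta> * s\<^sup>2 + d powr \<delta> * q\<^sup>2)"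
    by (simp add: algebra_simps)
  also have "\<dots> \<le> (1 + \<eta>) * ((1 + \<eta>)\<^sup>2 * b\<^sup>2 * (d powr (\<delta> - 2) * p\<^sup>2))
      + 2 * (1 + 1 / \<eta>) * (2 powr (2 * \<bar>b\<bar>) * (36 * (if d \<le> 4 * \<epsilon> then d powr (\<delta> + 2 * b - 2) else 0))
        + 2 powr (2 * \<bar>b\<bar>) * (k\<^sup>2 * d powr (\<delta> + 2 * b)))"
  proof (intro add_mono mult_left_mono)
    have "(d / t)\<^sup>2 \<le> (1 + \<eta>)\<^sup>2" using d t by (intro power_mono) (auto simp: field_simps)
    then have "(b\<^sup>2 * (d powr (\<delta> - 2) * p\<^sup>2)) * (d / t)\<^sup>2 \<le> (b\<^sup>2 * (d powr (\<delta> - 2) * p\<^sup>2)) * (1 + \<eta>)\<^sup>2"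
      by (intro mult_left_mono) auto
    moreover have "d powr \<delta> * A\<^sup>2 = (b\<^sup>2 * (d powr (\<delta> - 2) * p\<^sup>2)) * (d / t)\<^sup>2"
      unfolding d2 A_def by (simp add: power_divide power_mult_distrib)
    ultimately show "d powr \<delta> * A\<^sup>2 \<le> (1 + \<eta>)\<^sup>2 * b\<^sup>2 * (d powr (\<delta> - 2) * p\<^sup>2)"
      by (simp only: mult_ac)
  next
    show "d powr \<delta> * s\<^sup>2 \<le> 2 powr (2 * \<bar>b\<bar>) * (36 * (if d \<le> 4 * \<epsilon> then d powr (\<delta> + 2 * b - 2) else 0))"
    proof (cases "t < 2 * \<epsilon>")
      case True
      \<comment> \<open>This replaces \<open>2 / \<epsilon>\<close> by \<open>6 / d\<close>, whose
        square supplies the constant 36 and lowers the exponent by 2.\<close>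
      then have "d \<le> 3 * \<epsilon>" using td e\<eta> by linarith
      then have "(2 / \<epsilon>)\<^sup>2 \<le> (6 / d)\<^sup>2"
        using \<epsilon> d by (intro power_mono) (auto simp: field_simps)
      then have "d powr \<delta> * s\<^sup>2 \<le> d powr \<delta> * ((6 / d)\<^sup>2 * (2 powr (2 * \<bar>b\<bar>) * d powr (2 * b)))"
        unfolding s_def using True tb
        by (auto simp only: if_True power_mult_distrib intro!: mult_left_mono mult_mono) auto
      also have "\<dots> = 2 powr (2 * \<bar>b\<bar>) * (36 * d powr (\<delta> + 2 * b - 2))"
        using d(1) by (simp add: powr_add powr_diff power_divide)
      finally show ?thesis using \<open>d \<le> 3 * \<epsilon>\<close> \<epsilon> by simp
    qed (auto simp: s_def)
  next
    have "d powr \<delta> * q\<^sup>2 \<le> d powr \<delta> * (k\<^sup>2 * (2 powr (2 * \<bar>b\<bar>) * d powr (2 * b)))"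
      unfolding q_def power_mult_distrib using tb by (intro mult_left_mono) auto
    then show "d powr \<delta> * q\<^sup>2 \<le> 2 powr (2 * \<bar>b\<bar>) * (k\<^sup>2 * d powr (\<delta> + 2 * b))"
      by (simp add: powr_add mult_ac)
  qed (use \<eta> in auto)
  also have "\<dots> = (1 + \<eta>) ^ 3 * b\<^sup>2 * (d powr (\<delta> - 2) * p\<^sup>2)
      + 2 * (1 + 1 / \<eta>) * 2 powr (2 * \<bar>b\<bar>) *
        (36 * (if d \<le> 4 * \<epsilon> then d powr (\<delta> + 2 * b - 2) else 0) + k\<^sup>2 * d powr (\<delta> + 2 * b))"
    by (rule alg)
  finally show ?thesis .
qed

text \<open>The integrand is continuous on a compact set that keeps distance \<epsilon> from
  \<open>S\<close>, whatever the sign of \<open>e\<close>.\<close>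

lemma set_integrable_infdist_powr:
  fixes f :: "'a::euclidean_space \<Rightarrow> real"
  assumes "continuous_on UNIV f" "W \<in> sets borel" "bounded W" "0 < \<epsilon>"
    "\<And>y. y \<in> W \<Longrightarrow> \<epsilon> \<le> infdist y S"
  shows "set_integrable lborel W (\<lambda>y. infdist y S powr e * f y)"
proof -
  obtain c R where "W \<subseteq> cball c R" using \<open>bounded W\<close> bounded_subset_cball by metis
  define K where "K = cball c R \<inter> {y. \<epsilon> \<le> infdist y S}"
  have "closed {y. \<epsilon> \<le> infdist y S}" by (intro closed_Collect_le continuous_intros)
  then have "compact K" unfolding K_def by (intro compact_Int_closed) auto
  moreover have "continuous_on K (\<lambda>y. infdist y S powr e * f y)"
    using \<open>0 < \<epsilon>\<close> continuous_on_subset[OF assms(1), of K]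
    by (intro continuous_intros) (auto simp: K_def)
  ultimately have "set_integrable lborel K (\<lambda>y. infdist y S powr e * f y)"
    unfolding set_integrable_def by (rule borel_integrable_compact)
  then show ?thesis
    by (rule set_integrable_subset) (use assms \<open>W \<subseteq> cball c R\<close> in \<open>auto simp: K_def\<close>)
qed

lemma set_integral_eq_subset:
  fixes f :: "'a \<Rightarrow> real"
  assumes "W \<subseteq> A" "\<And>y. y \<in> A \<Longrightarrow> y \<notin> W \<Longrightarrow> f y = 0"
  shows "(LINT y:A|M. f y) = (LINT y:W|M. f y)"
proof -
  have "(\<lambda>y. indicator A y *\<^sub>R f y) = (\<lambda>y. indicator W y *\<^sub>R f y)"
    using assms by (auto simp: indicator_def fun_eq_iff)
  then show ?thesis by (simp only: set_lebesgue_integral_def)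
qed

lemma set_integral_mono_subset:
  fixes f :: "'a \<Rightarrow> real"
  assumes "set_integrable M B f" "A \<in> sets M" "A \<subseteq> B" "\<And>y. y \<in> B \<Longrightarrow> 0 \<le> f y"
  shows "(LINT y:A|M. f y) \<le> (LINT y:B|M. f y)"
proof -
  have "set_integrable M A f" using assms by (intro set_integrable_subset[OF assms(1)])
  then show ?thesis
    using assms unfolding set_lebesgue_integral_def set_integrable_def
    by (intro integral_mono) (auto simp: indicator_def)
qed

lemma norm_L2_hardy_squared:
  assumes hardy: "weighted_hardy \<Omega> \<delta> r a" and "\<psi> \<in> C1_compact_support (bdry_layer \<Omega> r)" and "0 \<le> a"
  shows "(LINT y:\<Omega>|lborel. dist_bdry \<Omega> y powr (\<delta> - 2) * (\<psi> y)\<^sup>2)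
    \<le> a\<^sup>2 * (LINT y:\<Omega>|lborel. dist_bdry \<Omega> y powr \<delta> * (norm (grad \<psi> y))\<^sup>2)"
proof -
  have nonneg: "0 \<le> (LINT y:\<Omega>|lborel. dist_bdry \<Omega> y powr \<delta> * (norm (grad \<psi> y))\<^sup>2)"
    "0 \<le> (LINT y:\<Omega>|lborel. dist_bdry \<Omega> y powr (\<delta> - 2) * (\<psi> y)\<^sup>2)"
    unfolding set_lebesgue_integral_def by (intro integral_nonneg_AE; simp)+
  have "sqrt (LINT y:\<Omega>|lborel. dist_bdry \<Omega> y powr (\<delta> - 2) * (\<psi> y)\<^sup>2)
      \<le> a * sqrt (LINT y:\<Omega>|lborel. dist_bdry \<Omega> y powr \<delta> * (norm (grad \<psi> y))\<^sup>2)"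
    using hardy \<open>\<psi> \<in> _\<close> unfolding weighted_hardy_def norm_L2_def
    by (simp add: abs_mult power_mult_distrib powr_square algebra_simps)
  from power_mono[OF this, of 2] show ?thesis
    using nonneg by (simp add: power_mult_distrib)
qed

text \<open>The exponent \<open>b\<close> is half of \<open>-(D + \<delta> - 2)\<close>, so that the
  weight times the squared test function is comparable to \<open>d powr (- D)\<close>. The main
  gradient term is then a fraction of the left hand side and is absorbed. \<open>C\<close> depends
  only on \<open>a\<close>, \<open>D\<close> and \<delta>, hence is uniform in the centre, the radii
  and \<epsilon>.\<close>

lemma hardy_caccioppoli:
  fixes \<Omega> :: "'a::euclidean_space set"
  assumes \<Omega>: "open \<Omega>" "frontier \<Omega> \<noteq> {}"
    and hardy: "weighted_hardy \<Omega> \<delta> r a" and a: "0 < a" "a * \<bar>D + \<delta> - 2\<bar> < 2"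
  obtains C where "0 < C"
    "\<And>c R1 R2 \<epsilon>. 0 < R1 \<Longrightarrow> R1 < R2 \<Longrightarrow> 0 < \<epsilon> \<Longrightarrow>
      (\<And>y. y \<in> \<Omega> \<inter> cball c R2 \<Longrightarrow> dist_bdry \<Omega> y < r) \<Longrightarrow>
      (LINT y:{y \<in> \<Omega> \<inter> ball c R1. 4 * \<epsilon> \<le> dist_bdry \<Omega> y}|lborel. dist_bdry \<Omega> y powr (- D))
      \<le> C * ((LINT y:{y \<in> \<Omega> \<inter> ball c R2. \<epsilon> / 2 \<le> dist_bdry \<Omega> y \<and> dist_bdry \<Omega> y \<le> 4 * \<epsilon>}|lborel.
                dist_bdry \<Omega> y powr (- D))
            + (LINT y:{y \<in> \<Omega> \<inter> ball c R2. \<epsilon> / 2 \<le> dist_bdry \<Omega> y}|lborel.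
                dist_bdry \<Omega> y powr (2 - D)) / (R2 - R1)\<^sup>2)"
proof -
  define d where "d = dist_bdry \<Omega>"
  define b where "b = - (D + \<delta> - 2) / 2"
  define \<beta> where "\<beta> = a * \<bar>b\<bar>"
  have "\<bar>D + \<delta> - 2\<bar> = 2 * \<bar>b\<bar>" by (simp add: b_def)
  then have \<beta>: "0 \<le> \<beta>" "\<beta> < 1" using a by (auto simp: \<beta>_def)
  have \<beta>2: "\<beta>\<^sup>2 < 1" using \<beta> by (simp add: power_less_one_iff abs_square_less_1)
  \<comment> \<open>Since \<open>(1 + \<eta>)^3 \<le> 1 + 7 * \<eta>\<close>, a loss of at most
    \<open>7 * \<eta>\<close> is added to \<open>\<beta>^2\<close>; the divisor 8 leaves the sum
    strictly below 1.\<close>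
  define \<eta> where "\<eta> = min (1/2) ((1 - \<beta>\<^sup>2) / 8)"
  have \<eta>: "0 < \<eta>" "\<eta> \<le> 1/2" "8 * \<eta> \<le> 1 - \<beta>\<^sup>2" using \<beta>2 by (auto simp: \<eta>_def min_def)
  define q where "q = a\<^sup>2 * ((1 + \<eta>) ^ 3 * b\<^sup>2)"
  have "q < 1"
  proof -
    have "\<eta> * \<eta> \<le> \<eta>" "\<eta> * \<eta> * \<eta> \<le> \<eta>"
      using \<eta> by (auto intro!: mult_left_le mult_le_one mult_left_le_one_le)
    then have "(1 + \<eta>) ^ 3 \<le> 1 + 7 * \<eta>" by (simp add: power3_eq_cube algebra_simps)
    then have "(1 + \<eta>) ^ 3 * \<beta>\<^sup>2 \<le> (1 + 7 * \<eta>) * \<beta>\<^sup>2" by (intro mult_right_mono) auto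
    also have "\<dots> \<le> \<beta>\<^sup>2 + 7 * \<eta>" using \<eta> \<beta>2 by (simp add: distrib_right mult_left_le)
    also have "\<dots> < 1" using \<eta> by linarith
    finally show ?thesis by (simp add: q_def \<beta>_def power_mult_distrib mult_ac)
  qed
  define C0 where "C0 = 2 * (1 + 1 / \<eta>) * 2 powr (2 * \<bar>b\<bar>)"
  have C0: "C0 > 0" unfolding C0_def using \<eta> by (intro mult_pos_pos add_pos_pos) auto
  \<comment> \<open>The power of 2 pays for comparing the smoothed distance with \<open>d\<close> on
    the inner region, the fraction for the absorption.\<close>
  define C where "C = 2 powr (2 * \<bar>b\<bar>) * (a\<^sup>2 * (C0 * 36) / (1 - q))"
  have eD: "\<delta> + 2 * b - 2 = - D" "\<delta> + 2 * b = 2 - D" by (simp_all add: b_def field_simps)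
  have [measurable]: "\<Omega> \<in> sets borel" using \<Omega> by simp
  have [measurable]: "d \<in> borel_measurable borel"
    unfolding d_def by (intro borel_measurable_continuous_onI continuous_intros)
  show thesis
  proof
    show "0 < C" using C0 a \<open>q < 1\<close> by (simp add: C_def)
  next
    fix c :: 'a and R1 R2 \<epsilon> :: real
    assume R: "0 < R1" "R1 < R2" and \<epsilon>: "0 < \<epsilon>"
      and layer: "\<And>y. y \<in> \<Omega> \<inter> cball c R2 \<Longrightarrow> dist_bdry \<Omega> y < r"
    define k where "k = 4 / (R2 - R1)"
    have h: "0 < \<eta> * \<epsilon>" "\<eta> * \<epsilon> \<le> \<epsilon> / 2" using \<eta> \<epsilon> by auto
    obtain \<psi> where \<psi>: "\<psi> \<in> C1_compact_support (bdry_layer \<Omega> r)"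
      "\<And>y. \<psi> y \<noteq> 0 \<or> grad \<psi> y \<noteq> 0 \<Longrightarrow> y \<in> \<Omega> \<inter> ball c R2 \<and>
        (\<exists>t>\<epsilon>. \<bar>t - dist_bdry \<Omega> y\<bar> \<le> \<eta> * \<epsilon> \<and>
          norm (grad \<psi> y) \<le> \<bar>b\<bar> * \<bar>\<psi> y\<bar> / t + (if t < 2 * \<epsilon> then 2 / \<epsilon> * t powr b else 0)
            + 4 / (R2 - R1) * t powr b)"
      "\<And>y. y \<in> \<Omega> \<inter> ball c R1 \<Longrightarrow> 4 * \<epsilon> \<le> dist_bdry \<Omega> y \<Longrightarrow>
        \<exists>t. \<bar>t - dist_bdry \<Omega> y\<bar> \<le> \<eta> * \<epsilon> \<and> \<psi> y = t powr b"
      using hardy_test_function[OF \<Omega> R h layer, where b = b] by blast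
    define W where "W = {y \<in> \<Omega> \<inter> ball c R2. \<epsilon> / 2 \<le> d y}"
    define W1 where "W1 = {y \<in> \<Omega> \<inter> ball c R1. 4 * \<epsilon> \<le> d y}"
    define W2 where "W2 = {y \<in> \<Omega> \<inter> ball c R2. \<epsilon> / 2 \<le> d y \<and> d y \<le> 4 * \<epsilon>}"
    have sets[measurable]: "W \<in> sets borel" "W1 \<in> sets borel" "W2 \<in> sets borel"
      unfolding W_def W1_def W2_def by measurable
    have sub: "W \<subseteq> \<Omega>" "W1 \<subseteq> W" "W2 \<subseteq> W" using R \<epsilon> by (auto simp: W_def W1_def W2_def)
    have bW: "bounded W" by (rule bounded_subset[of "ball c R2"]) (auto simp: W_def)
    have int: "set_integrable lborel W (\<lambda>y. d y powr e * f y)" if "continuous_on UNIV f" for e f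
      unfolding d_def
      by (rule set_integrable_infdist_powr[OF that sets(1) bW, of "\<epsilon> / 2"]) (use \<epsilon> in \<open>auto simp: W_def d_def\<close>)
    have int1: "set_integrable lborel W (\<lambda>y. d y powr e)" for e
      using int[of "\<lambda>_. 1" e] by simp
    have \<psi>_diff: "\<forall>x. \<psi> differentiable (at x)" and cont_grad: "continuous_on UNIV (grad \<psi>)"
      using \<psi>(1) by (auto simp: C1_compact_support_def)
    have cont\<psi>: "continuous_on UNIV \<psi>"
      using \<psi>_diff by (auto intro!: continuous_at_imp_continuous_on differentiable_imp_continuous_within)
    \<comment> \<open>On the support \<open>t > \<epsilon>\<close>, and \<open>t\<close> differs
      from \<open>d y\<close> by at most \<open>\<epsilon> / 2\<close>. Hence all integrals reduce
      to \<open>W\<close>, where the powers of \<open>d\<close> are integrable.\<close>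
    have zero: "\<psi> y = 0 \<and> grad \<psi> y = 0" if y: "y \<notin> W" for y
    proof (rule ccontr)
      assume "\<not> ?thesis"
      with \<psi>(2)[of y] obtain t where "y \<in> \<Omega> \<inter> ball c R2" "t > \<epsilon>" "\<bar>t - d y\<bar> \<le> \<eta> * \<epsilon>"
        unfolding d_def by blast
      then have "y \<in> W" using h by (auto simp: W_def)
      with y show False by blast
    qed
    define X where "X = (LINT y:W|lborel. d y powr (\<delta> - 2) * (\<psi> y)\<^sup>2)"
    define Y1 where "Y1 = (LINT y:W2|lborel. d y powr (- D))"
    define Y2 where "Y2 = (LINT y:W|lborel. d y powr (2 - D))"
    define I where "I = (LINT y:W1|lborel. d y powr (- D))"
    have Y: "0 \<le> Y1" "0 \<le> Y2" unfolding Y1_def Y2_def set_lebesgue_integral_def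
      by (intro integral_nonneg_AE; simp)+
    have intX: "set_integrable lborel W (\<lambda>y. d y powr (\<delta> - 2) * (\<psi> y)\<^sup>2)"
      by (intro int continuous_intros cont\<psi>)
    have intG: "set_integrable lborel W (\<lambda>y. d y powr \<delta> * (norm (grad \<psi> y))\<^sup>2)"
      by (intro int continuous_intros cont_grad)
    have indW2: "(\<lambda>y. indicator W y *\<^sub>R (indicator W2 y * d y powr (- D))) =
        (\<lambda>y. indicator W2 y *\<^sub>R d y powr (- D))"
      using sub by (auto simp: indicator_def fun_eq_iff)
    have "set_integrable lborel W2 (\<lambda>y. d y powr (- D))"
      by (rule set_integrable_subset[OF int1]) (use sub in auto)
    then have intW2: "set_integrable lborel W (\<lambda>y. indicator W2 y * d y powr (- D))"
      by (simp only: set_integrable_def indW2)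
    have lintW2: "(LINT y:W|lborel. indicator W2 y * d y powr (- D)) = Y1"
      by (simp only: set_lebesgue_integral_def Y1_def indW2)
    have "X = (LINT y:\<Omega>|lborel. d y powr (\<delta> - 2) * (\<psi> y)\<^sup>2)"
      unfolding X_def by (rule set_integral_eq_subset[symmetric]) (use sub zero in auto)
    also have "\<dots> \<le> a\<^sup>2 * (LINT y:\<Omega>|lborel. d y powr \<delta> * (norm (grad \<psi> y))\<^sup>2)"
      unfolding d_def using norm_L2_hardy_squared[OF hardy \<psi>(1)] a by simp
    also have "(LINT y:\<Omega>|lborel. d y powr \<delta> * (norm (grad \<psi> y))\<^sup>2) = (LINT y:W|lborel. d y powr \<delta> * (norm (grad \<psi> y))\<^sup>2)"
      by (rule set_integral_eq_subset) (use sub zero in auto)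
    also have "\<dots> \<le> (LINT y:W|lborel. (1 + \<eta>) ^ 3 * b\<^sup>2 * (d y powr (\<delta> - 2) * (\<psi> y)\<^sup>2)
        + C0 * (36 * (indicator W2 y * d y powr (- D)) + k\<^sup>2 * d y powr (2 - D)))"
    proof (rule set_integral_mono[OF intG])
      show "set_integrable lborel W (\<lambda>y. (1 + \<eta>) ^ 3 * b\<^sup>2 * (d y powr (\<delta> - 2) * (\<psi> y)\<^sup>2)
        + C0 * (36 * (indicator W2 y * d y powr (- D)) + k\<^sup>2 * d y powr (2 - D)))"
        by (intro set_integral_add set_integrable_mult_right intX intW2 int1)
    next
      fix y assume y: "y \<in> W"
      show "d y powr \<delta> * (norm (grad \<psi> y))\<^sup>2 \<le> (1 + \<eta>) ^ 3 * b\<^sup>2 * (d y powr (\<delta> - 2) * (\<psi> y)\<^sup>2)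
        + C0 * (36 * (indicator W2 y * d y powr (- D)) + k\<^sup>2 * d y powr (2 - D))"
      proof (cases "\<psi> y = 0 \<and> grad \<psi> y = 0")
        case True
        then show ?thesis using C0 by auto
      next
        case False
        with \<psi>(2)[of y] obtain t where t: "t > \<epsilon>" "\<bar>t - d y\<bar> \<le> \<eta> * \<epsilon>"
          "norm (grad \<psi> y) \<le> \<bar>b\<bar> * \<bar>\<psi> y\<bar> / t + (if t < 2 * \<epsilon> then 2 / \<epsilon> * t powr b else 0) + k * t powr b"
          unfolding d_def k_def by blast
        have ind: "(if d y \<le> 4 * \<epsilon> then d y powr (- D) else 0) = indicator W2 y * d y powr (- D)"
          using y by (auto simp: W2_def W_def)
        have "k \<ge> 0" using R by (simp add: k_def)
        from hardy_pointwise[OF \<epsilon> t(1) \<eta>(1,2) t(2) abs_ge_zero this norm_ge_zero t(3), of \<delta>]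
        show ?thesis unfolding eD(1) C0_def[symmetric] ind unfolding eD(2) by simp
      qed
    qed
    also have "\<dots> = (1 + \<eta>) ^ 3 * b\<^sup>2 * X + C0 * (36 * Y1 + k\<^sup>2 * Y2)"
      using intX intW2 int1
      by (simp add: set_integral_add set_integrable_mult_right set_integral_mult_right lintW2 X_def[symmetric] Y2_def[symmetric])
    finally have "X \<le> a\<^sup>2 * ((1 + \<eta>) ^ 3 * b\<^sup>2 * X + C0 * (36 * Y1 + k\<^sup>2 * Y2))"
      using a by simp
    also have "\<dots> = q * X + a\<^sup>2 * (C0 * (36 * Y1 + k\<^sup>2 * Y2))" by (simp add: q_def algebra_simps)
    \<comment> \<open>The absorption of the main term; \<open>q < 1\<close> permits the division
      that follows.\<close>
    finally have "(1 - q) * X \<le> a\<^sup>2 * (C0 * (36 * Y1 + k\<^sup>2 * Y2))" by (simp add: algebra_simps)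
    then have "X \<le> a\<^sup>2 * (C0 * (36 * Y1 + k\<^sup>2 * Y2)) / (1 - q)"
      using \<open>q < 1\<close> by (simp add: field_simps)
    also have "\<dots> \<le> a\<^sup>2 * (C0 * (36 * (Y1 + Y2 / (R2 - R1)\<^sup>2))) / (1 - q)"
    proof -
      \<comment> \<open>\<open>k^2\<close> is \<open>16 / (R2 - R1)^2\<close>; enlarging 16 to 36
        gives both error terms the same factor.\<close>
      have "k\<^sup>2 * Y2 \<le> 36 * (Y2 / (R2 - R1)\<^sup>2)"
        using Y R by (auto simp: k_def power_divide intro!: divide_right_mono)
      then show ?thesis using C0 \<open>q < 1\<close> Y
        by (intro divide_right_mono mult_left_mono) auto
    qed
    finally have X: "X \<le> a\<^sup>2 * (C0 * 36) / (1 - q) * (Y1 + Y2 / (R2 - R1)\<^sup>2)" by (simp add: mult_ac)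
    \<comment> \<open>On \<open>W1\<close> both cut-offs equal 1, so the test function is a pure
      power of the smoothed distance.\<close>
    have "I \<le> (LINT y:W1|lborel. 2 powr (2 * \<bar>b\<bar>) * (d y powr (\<delta> - 2) * (\<psi> y)\<^sup>2))"
      unfolding I_def
    proof (rule set_integral_mono)
      show "set_integrable lborel W1 (\<lambda>y. d y powr - D)"
        by (rule set_integrable_subset[OF int1]) (use sub in auto)
      show "set_integrable lborel W1 (\<lambda>y. 2 powr (2 * \<bar>b\<bar>) * (d y powr (\<delta> - 2) * (\<psi> y)\<^sup>2))"
        by (intro set_integrable_mult_right, rule set_integrable_subset[OF intX]) (use sub in auto)
    next
      fix y assume y: "y \<in> W1"
      then obtain t where t: "\<bar>t - d y\<bar> \<le> \<eta> * \<epsilon>" "\<psi> y = t powr b"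
        using \<psi>(3)[of y] unfolding W1_def d_def by blast
      have dy: "4 * \<epsilon> \<le> d y" using y by (simp add: W1_def)
      have "d y powr (2 * b) \<le> 2 powr \<bar>2 * b\<bar> * t powr (2 * b)"
        by (rule powr_le_comparable) (use dy t h \<epsilon> in linarith)+
      then have "d y powr (\<delta> - 2) * d y powr (2 * b) \<le> d y powr (\<delta> - 2) * (2 powr \<bar>2 * b\<bar> * t powr (2 * b))"
        by (intro mult_left_mono) auto
      moreover have "d y powr (\<delta> - 2) * d y powr (2 * b) = d y powr (- D)"
        unfolding powr_add[symmetric] eD(1)[symmetric] by (simp add: algebra_simps)
      ultimately show "d y powr - D \<le> 2 powr (2 * \<bar>b\<bar>) * (d y powr (\<delta> - 2) * (\<psi> y)\<^sup>2)"
        unfolding t(2) powr_square by (simp add: abs_mult mult_ac)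
    qed
    also have "\<dots> = 2 powr (2 * \<bar>b\<bar>) * (LINT y:W1|lborel. d y powr (\<delta> - 2) * (\<psi> y)\<^sup>2)"
      by simp
    also have "\<dots> \<le> 2 powr (2 * \<bar>b\<bar>) * X"
    proof (intro mult_left_mono)
      show "(LINT y:W1|lborel. d y powr (\<delta> - 2) * (\<psi> y)\<^sup>2) \<le> X"
        unfolding X_def by (rule set_integral_mono_subset[OF intX]) (use sub in auto)
    qed auto
    also have "\<dots> \<le> 2 powr (2 * \<bar>b\<bar>) * (a\<^sup>2 * (C0 * 36) / (1 - q) * (Y1 + Y2 / (R2 - R1)\<^sup>2))"
      using X by (intro mult_left_mono) auto
    finally have "I \<le> C * (Y1 + Y2 / (R2 - R1)\<^sup>2)" by (simp add: C_def)
    then show "(LINT y:{y \<in> \<Omega> \<inter> ball c R1. 4 * \<epsilon> \<le> dist_bdry \<Omega> y}|lborel. dist_bdry \<Omega> y powr (- D))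
      \<le> C * ((LINT y:{y \<in> \<Omega> \<inter> ball c R2. \<epsilon> / 2 \<le> dist_bdry \<Omega> y \<and> dist_bdry \<Omega> y \<le> 4 * \<epsilon>}|lborel.
                dist_bdry \<Omega> y powr (- D))
            + (LINT y:{y \<in> \<Omega> \<inter> ball c R2. \<epsilon> / 2 \<le> dist_bdry \<Omega> y}|lborel.
                dist_bdry \<Omega> y powr (2 - D)) / (R2 - R1)\<^sup>2)"
      unfolding I_def Y1_def Y2_def W_def W1_def W2_def d_def .
  qed
qed

section \<open>Boundaries of positive measure\<close>

lemma bounded_borel_fmeasurable:
  fixes S :: "'a::euclidean_space set"
  assumes "S \<in> sets borel" "bounded S"
  shows "S \<in> fmeasurable lborel"
  using assms emeasure_bounded_finite[of S] by (auto intro: fmeasurableI)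

lemma fmeasurable_measure_mono:
  "A \<in> fmeasurable M \<Longrightarrow> B \<in> fmeasurable M \<Longrightarrow> A \<subseteq> B \<Longrightarrow> measure M A \<le> measure M B"
  by (intro measure_mono_fmeasurable fmeasurableD)

lemma set_integral_const_le:
  fixes c :: real
  assumes "S \<in> fmeasurable M" "set_integrable M S f" "\<And>y. y \<in> S \<Longrightarrow> c \<le> f y"
  shows "c * measure M S \<le> (LINT y:S|M. f y)"
proof -
  have S: "S \<in> sets M" "emeasure M S \<noteq> \<infinity>" using assms(1) by (auto simp: fmeasurable_def)
  have "set_integrable M S (\<lambda>_. c)"
    using S unfolding set_integrable_def by (auto simp: top.not_eq_extremum)
  then have "(LINT y:S|M. c) \<le> (LINT y:S|M. f y)" by (rule set_integral_mono) (use assms in auto)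
  then show ?thesis by (simp add: set_integral_const[OF S] mult.commute)
qed

lemma set_integral_le_const:
  fixes c :: real
  assumes "S \<in> fmeasurable M" "set_integrable M S f" "\<And>y. y \<in> S \<Longrightarrow> f y \<le> c"
  shows "(LINT y:S|M. f y) \<le> c * measure M S"
proof -
  have S: "S \<in> sets M" "emeasure M S \<noteq> \<infinity>" using assms(1) by (auto simp: fmeasurable_def)
  have "set_integrable M S (\<lambda>_. c)"
    using S unfolding set_integrable_def by (auto simp: top.not_eq_extremum)
  then have "(LINT y:S|M. f y) \<le> (LINT y:S|M. c)" by (intro set_integral_mono assms) auto
  then show ?thesis by (simp add: set_integral_const[OF S] mult.commute)
qed

lemma infdist_lessE:
  assumes "A \<noteq> {}" "infdist y A < r"
  obtains p where "p \<in> A" "dist y p < r"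
proof -
  have "(INF a\<in>A. dist y a) < r" using assms by (simp add: infdist_notempty)
  moreover have "bdd_below ((\<lambda>a. dist y a) ` A)" by (rule bdd_belowI2[where m=0]) simp
  ultimately show thesis using that assms(1) by (subst (asm) cINF_less_iff) auto
qed

lemma infdist_less_fmeasurable:
  fixes A :: "'a::euclidean_space set"
  assumes "bounded A" "A \<noteq> {}"
  shows "{y. infdist y A < r} \<in> fmeasurable lborel"
proof (rule bounded_borel_fmeasurable)
  have "open {y. infdist y A < r}" by (intro open_Collect_less continuous_intros)
  then show "{y. infdist y A < r} \<in> sets borel" by simp
  obtain c R where "A \<subseteq> cball c R" using assms(1) bounded_subset_cball by metis
  have "{y. infdist y A < r} \<subseteq> cball c (R + r)"
  proof
    fix y assume "y \<in> {y. infdist y A < r}"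
    then obtain p where "p \<in> A" "dist y p < r"
      using infdist_lessE[OF assms(2)] by blast
    moreover have "dist c p \<le> R" using \<open>A \<subseteq> cball c R\<close> \<open>p \<in> A\<close> by auto
    ultimately show "y \<in> cball c (R + r)"
      using dist_triangle[of c y p] by (simp add: dist_commute)
  qed
  then show "bounded {y. infdist y A < r}" using bounded_subset bounded_cball by blast
qed

lemma inner_nbhd_fmeasurable:
  fixes \<Omega> A :: "'a::euclidean_space set"
  assumes "bounded A" "A \<noteq> {}"
  shows "inner_nbhd \<Omega> A r \<in> fmeasurable lborel"
proof -
  have "inner_nbhd \<Omega> A r = {y. infdist y A < r} \<inter> closure \<Omega>" by (auto simp: inner_nbhd_def)
  then show ?thesis
    using infdist_less_fmeasurable[OF assms] by (simp add: fmeasurable_Int_fmeasurable)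
qed

lemma ball_infdist_disjoint:
  assumes "u \<in> ball y r" "r \<le> infdist y A"
  shows "u \<notin> A"
  using assms infdist_le[of u A y] by fastforce

lemma infdist_frontier_pos:
  assumes "open \<Omega>" "frontier \<Omega> \<noteq> {}" "y \<in> \<Omega>"
  shows "infdist y (frontier \<Omega>) > 0"
  using assms by (intro infdist_pos_not_in_closed) (auto simp: frontier_def interior_open)

text \<open>Continuity of the measure from above: the neighbourhoods have finite measure and
  decrease to \<open>E\<close> because \<open>E\<close> is closed.\<close>

lemma measure_infdist_less_tendsto:
  fixes E :: "'a::euclidean_space set"
  assumes "compact E" "E \<noteq> {}"
  shows "(\<lambda>n. measure lborel {y. infdist y E < 1 / real (Suc n)}) \<longlonglongrightarrow> measure lborel E"
proof -
  define A where "A n = {y. infdist y E < 1 / real (Suc n)}" for n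
  have A_meas: "A n \<in> fmeasurable lborel" for n
    unfolding A_def by (rule infdist_less_fmeasurable[OF compact_imp_bounded[OF assms(1)] assms(2)])
  have "(\<lambda>n. measure lborel (A n)) \<longlonglongrightarrow> measure lborel (\<Inter>n. A n)"
  proof (rule Lim_measure_decseq)
    show "range A \<subseteq> sets lborel" using A_meas fmeasurableD by blast
    show "decseq A" unfolding decseq_def A_def
      by (auto elim!: less_le_trans simp: frac_le)
    show "emeasure lborel (A i) \<noteq> \<infinity>" for i
      using A_meas[of i] by (auto simp: fmeasurable_def)
  qed
  moreover have "(\<Inter>n. A n) = E"
  proof
    show "E \<subseteq> (\<Inter>n. A n)" by (auto simp: A_def)
    show "(\<Inter>n. A n) \<subseteq> E"
    proof
      fix y assume y: "y \<in> (\<Inter>n. A n)"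
      have "\<not> infdist y E > 0"
      proof
        assume "infdist y E > 0"
        then obtain n where "1 / real (Suc n) < infdist y E" using nat_approx_posE by blast
        moreover have "infdist y E < 1 / real (Suc n)" using y by (auto simp: A_def)
        ultimately show False by simp
      qed
      then have "infdist y E = 0" using infdist_nonneg[of y E] by linarith
      then show "y \<in> E"
        using in_closed_iff_infdist_zero[OF compact_imp_closed[OF assms(1)] assms(2)] by simp
    qed
  qed
  ultimately show ?thesis by (simp add: A_def)
qed

text \<open>A compact set that is porous at scale \<open>\<rho>\<close> misses a fixed proportion of its \<open>\<rho>\<close>-neighbourhood,
  by the Vitali covering lemma. For small \<open>\<rho>\<close> this contradicts positive measure.\<close>

lemma compact_positive_measure_not_porous:
  fixes E :: "'a::euclidean_space set"
  assumes E: "compact E" "measure lborel E > 0" and c: "0 < c"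
  obtains \<rho>\<^sub>0 where "\<rho>\<^sub>0 > 0"
    "\<And>\<rho>. 0 < \<rho> \<Longrightarrow> \<rho> \<le> \<rho>\<^sub>0 \<Longrightarrow> \<exists>z\<in>E. \<forall>w. \<not> ball w (c * \<rho>) \<subseteq> ball z \<rho> - E"
proof -
  let ?n = "DIM('a)"
  have "E \<noteq> {}" using E by auto
  \<comment> \<open>The ratio of the volumes of a hole of radius \<open>c * \<rho>\<close> and of a
    Vitali ball of radius \<open>5 * \<rho>\<close>.\<close>
  define \<gamma> where "\<gamma> = (c / 5) ^ ?n"
  have "\<gamma> > 0" using c by (simp add: \<gamma>_def)
  define A where "A \<rho> = {y. infdist y E < \<rho>}" for \<rho>
  have "\<forall>\<^sub>F n in sequentially. measure lborel (A (1 / real (Suc n))) < (1 + \<gamma>) * measure lborel E"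
    unfolding A_def using measure_infdist_less_tendsto[OF E(1) \<open>E \<noteq> {}\<close>]
    by (rule order_tendstoD) (use E(2) \<open>\<gamma> > 0\<close> in simp)
  then obtain N where N: "measure lborel (A (1 / real (Suc N))) < (1 + \<gamma>) * measure lborel E"
    unfolding eventually_sequentially by blast
  define \<rho>\<^sub>0 where "\<rho>\<^sub>0 = 1 / real (Suc N)"
  have A_meas: "A \<rho> \<in> fmeasurable lborel" for \<rho>
    unfolding A_def by (rule infdist_less_fmeasurable[OF compact_imp_bounded[OF E(1)] \<open>E \<noteq> {}\<close>])
  have E_meas: "E \<in> fmeasurable lborel" using E(1) by (rule fmeasurable_compact)
  show thesis
  proof
    show "\<rho>\<^sub>0 > 0" by (simp add: \<rho>\<^sub>0_def)
  next
    fix \<rho> :: real assume \<rho>: "0 < \<rho>" "\<rho> \<le> \<rho>\<^sub>0"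
    show "\<exists>z\<in>E. \<forall>w. \<not> ball w (c * \<rho>) \<subseteq> ball z \<rho> - E"
    proof (rule ccontr)
      assume "\<not> ?thesis"
      then obtain w where w: "\<And>z. z \<in> E \<Longrightarrow> ball (w z) (c * \<rho>) \<subseteq> ball z \<rho> - E" by metis
      obtain F where F: "finite F" "F \<subseteq> E" "E \<subseteq> (\<Union>z\<in>F. ball z \<rho>)"
      proof (rule compactE_image[OF E(1), of E "\<lambda>z. ball z \<rho>"])
        show "E \<subseteq> (\<Union>z\<in>E. ball z \<rho>)" using \<rho> by auto
      qed auto
      obtain Z where Z: "Z \<subseteq> F" "pairwise (\<lambda>i j. disjnt (ball i \<rho>) (ball j \<rho>)) Z"
        "E \<subseteq> (\<Union>z\<in>Z. ball z (5 * \<rho>))"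
      proof (rule Vitali_covering_lemma_balls[where S=E and K=F and a="\<lambda>z. z" and r="\<lambda>_. \<rho>" and B=\<rho>])
        show "E \<subseteq> (\<Union>z\<in>F. ball z \<rho>)" by (rule F(3))
        show "0 < \<rho> \<and> \<rho> \<le> \<rho>" using \<rho> by simp
      qed
      have "finite Z" using Z(1) F(1) finite_subset by blast
      define \<omega> where "\<omega> = unit_ball_vol (real ?n)"
      have vol: "measure lborel (ball z t) = \<omega> * t ^ ?n" if "t \<ge> 0" for z :: 'a and t
        using that by (simp add: content_ball \<omega>_def)
      have ball_meas: "ball z t \<in> fmeasurable lborel" for z :: 'a and t
        by (rule bounded_borel_fmeasurable) auto
      have "measure lborel E \<le> measure lborel (\<Union>z\<in>Z. ball z (5 * \<rho>))"
        using Z(3) E_meas \<open>finite Z\<close> ball_meas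
        by (intro measure_mono_fmeasurable fmeasurable.finite_UN) auto
      also have "\<dots> \<le> (\<Sum>z\<in>Z. measure lborel (ball z (5 * \<rho>)))"
        using \<open>finite Z\<close> by (intro measure_UNION_le) auto
      also have "\<dots> = real (card Z) * (\<omega> * (5 * \<rho>) ^ ?n)"
        using vol[of "5 * \<rho>"] \<rho> by simp
      finally have "\<gamma> * measure lborel E \<le> \<gamma> * (real (card Z) * (\<omega> * (5 * \<rho>) ^ ?n))"
        using \<open>\<gamma> > 0\<close> by (intro mult_left_mono) auto
      also have "\<dots> = real (card Z) * (\<omega> * (c * \<rho>) ^ ?n)"
        by (simp add: \<gamma>_def power_mult_distrib power_divide)
      also have "\<dots> = (\<Sum>z\<in>Z. measure lborel (ball (w z) (c * \<rho>)))"
        using vol[of "c * \<rho>"] c \<rho> by simp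
      \<comment> \<open>The holes are disjoint because each lies in its own ball of the disjoint
        Vitali family.\<close>
      also have "\<dots> = measure lborel (\<Union>z\<in>Z. ball (w z) (c * \<rho>))"
      proof (rule measure_UNION'[symmetric])
        show "pairwise (\<lambda>i j. disjnt (ball (w i) (c * \<rho>)) (ball (w j) (c * \<rho>))) Z"
          using Z(2) w Z(1) F(2) unfolding pairwise_def disjnt_def by blast
      qed (use \<open>finite Z\<close> ball_meas in auto)
      also have "\<dots> \<le> measure lborel (A \<rho> - E)"
      proof (rule measure_mono_fmeasurable)
        show "(\<Union>z\<in>Z. ball (w z) (c * \<rho>)) \<subseteq> A \<rho> - E"
        proof
          fix y assume "y \<in> (\<Union>z\<in>Z. ball (w z) (c * \<rho>))"
          then obtain z where "z \<in> E" "y \<in> ball z \<rho> - E" using w Z(1) F(2) by blast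
          then show "y \<in> A \<rho> - E"
            using infdist_le[of z E y] by (auto simp: A_def dist_commute)
        qed
        show "A \<rho> - E \<in> fmeasurable lborel" using A_meas E_meas by (auto intro: fmeasurable_Diff)
      qed (auto intro!: borel_open)
      also have "\<dots> = measure lborel (A \<rho>) - measure lborel E"
        using A_meas E_meas \<rho> by (intro measurable_measure_Diff) (auto simp: A_def)
      also have "measure lborel (A \<rho>) \<le> measure lborel (A \<rho>\<^sub>0)"
        by (rule measure_mono_fmeasurable[OF _ fmeasurableD[OF A_meas] A_meas])
          (use \<rho> in \<open>auto simp: A_def\<close>)
      \<comment> \<open>The holes give \<open>(1 + \<gamma>) * measure lborel E\<close> as a lower
        bound for the measure of the neighbourhood, against the choice of \<open>N\<close>.\<close>
      finally show False using N by (simp add: \<rho>\<^sub>0_def algebra_simps)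
    qed
  qed
qed

text \<open>The point is a maximiser of \<open>d(u) - |u - y\<^sub>0| / M\<close> near a non-porous boundary point.\<close>

lemma exists_point_dominating_dist:
  fixes \<Omega> :: "'a::euclidean_space set"
  assumes "open \<Omega>" and E: "compact E" "E \<subseteq> frontier \<Omega>" "measure lborel E > 0"
    and M: "M \<ge> 1" and "\<sigma> > 0"
  obtains y where "y \<in> \<Omega>" "dist_bdry \<Omega> y < \<sigma>"
    "\<And>u. u \<in> \<Omega> \<inter> cball y (M * dist_bdry \<Omega> y) \<Longrightarrow> dist_bdry \<Omega> u \<le> 2 * dist_bdry \<Omega> y"
proof -
  define d where "d = dist_bdry \<Omega>"
  have fr: "frontier \<Omega> \<noteq> {}" using E by auto
  \<comment> \<open>Chosen so that \<open>d y < c * \<rho>\<close> yields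
    \<open>M * d y < \<rho> / 16\<close>.\<close>
  define c where "c = 1 / (16 * M)"
  have c: "0 < c" "c \<le> 1/2" using M by (auto simp: c_def field_simps)
  obtain \<rho>\<^sub>0 where \<rho>\<^sub>0: "\<rho>\<^sub>0 > 0"
    "\<And>\<rho>. 0 < \<rho> \<Longrightarrow> \<rho> \<le> \<rho>\<^sub>0 \<Longrightarrow> \<exists>z\<in>E. \<forall>w. \<not> ball w (c * \<rho>) \<subseteq> ball z \<rho> - E"
    using compact_positive_measure_not_porous[OF E(1,3) c(1)] by blast
  define \<rho> where "\<rho> = min \<rho>\<^sub>0 \<sigma>"
  have \<rho>: "0 < \<rho>" "\<rho> \<le> \<rho>\<^sub>0" "\<rho> \<le> \<sigma>" using \<rho>\<^sub>0(1) \<open>\<sigma> > 0\<close> by (auto simp: \<rho>_def)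
  from \<rho>\<^sub>0(2)[OF \<rho>(1,2)] obtain z where z: "z \<in> E" "\<And>w. \<not> ball w (c * \<rho>) \<subseteq> ball z \<rho> - E" by blast
  have c\<rho>: "c * \<rho> \<le> \<rho> / 2" using mult_right_mono[OF c(2), of \<rho>] \<rho> by simp
  \<comment> \<open>Otherwise a ball of radius \<open>c * \<rho>\<close> around \<open>u\<close>
    would miss the boundary and be a hole near \<open>z\<close>.\<close>
  have small: "d u < c * \<rho>" if u: "u \<in> ball z (\<rho> / 2)" for u
  proof (rule ccontr)
    assume "\<not> d u < c * \<rho>"
    then have "v \<notin> frontier \<Omega>" if "v \<in> ball u (c * \<rho>)" for v
      using ball_infdist_disjoint[OF that] by (simp add: d_def)
    moreover have "ball u (c * \<rho>) \<subseteq> ball z \<rho>"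
    proof
      fix v assume "v \<in> ball u (c * \<rho>)"
      then show "v \<in> ball z \<rho>" using u c\<rho> dist_triangle[of z v u] by auto
    qed
    ultimately have "ball u (c * \<rho>) \<subseteq> ball z \<rho> - E" using E(2) by blast
    with z(2) show False by blast
  qed
  have "z \<in> closure \<Omega>" using z(1) E(2) by (auto simp: frontier_def)
  then obtain y0 where y0: "y0 \<in> \<Omega>" "dist y0 z < \<rho> / 4"
    unfolding closure_approachable using \<rho> by (metis zero_less_divide_iff zero_less_numeral)
  \<comment> \<open>The radius is \<open>\<rho> / 4\<close> for the way from \<open>z\<close> to
    \<open>y0\<close> plus twice \<open>\<rho> / 16\<close>, for the ways from \<open>y0\<close> to
    the maximiser \<open>y\<close> and from \<open>y\<close> to a competitor
    \<open>u\<close>.\<close>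
  define D where "D = closure \<Omega> \<inter> cball z (3 * \<rho> / 8)"
  define G where "G u = d u - dist u y0 / M" for u
  have "compact D" unfolding D_def by (intro closed_Int_compact) auto
  moreover have y0D: "y0 \<in> D" using y0 \<rho> closure_subset[of \<Omega>] by (auto simp: D_def dist_commute)
  moreover have "continuous_on D G" unfolding G_def d_def using M by (intro continuous_intros) auto
  ultimately obtain y where y: "y \<in> D" "\<And>u. u \<in> D \<Longrightarrow> G u \<le> G y"
    using continuous_attains_sup[of D G] by blast
  have "d y0 > 0" unfolding d_def using infdist_frontier_pos[OF \<open>open \<Omega>\<close> fr y0(1)] .
  \<comment> \<open>Comparison with \<open>y0\<close> shows that the maximiser, found only in the
    closure, has \<open>d y > 0\<close> and lies within \<open>M * d y\<close> of
    \<open>y0\<close>.\<close>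
  have "d y0 + dist y y0 / M \<le> d y" using y(2)[OF y0D] by (simp add: G_def)
  moreover have "dist y y0 / M \<ge> 0" using M by simp
  ultimately have dy: "0 < d y" "dist y y0 / M \<le> d y" using \<open>d y0 > 0\<close> by linarith+
  have "y \<notin> frontier \<Omega>" using dy(1) unfolding d_def by auto
  then have "y \<in> \<Omega>" using y(1) \<open>open \<Omega>\<close> by (auto simp: D_def frontier_def interior_open)
  have "y \<in> ball z (\<rho> / 2)" using y(1) \<rho> by (auto simp: D_def)
  then have dy_small: "d y < c * \<rho>" by (rule small)
  then have Mdy: "M * d y < \<rho> / 16" using M by (simp add: c_def field_simps)
  have "dist y y0 \<le> M * d y" using dy(2) M by (simp add: field_simps)
  show thesis
  proof
    show "y \<in> \<Omega>" by fact
    show "dist_bdry \<Omega> y < \<sigma>" using dy_small c\<rho> \<rho> unfolding d_def by linarith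
  next
    fix u assume "u \<in> \<Omega> \<inter> cball y (M * dist_bdry \<Omega> y)"
    then have u: "u \<in> \<Omega>" "dist y u \<le> M * d y" by (auto simp: d_def)
    have "dist z u \<le> dist z y0 + dist y0 y + dist y u"
      using dist_triangle[of z u y0] dist_triangle[of y0 u y] by linarith
    also have "\<dots> \<le> 3 * \<rho> / 8"
      using y0(2) \<open>dist y y0 \<le> M * d y\<close> u(2) Mdy by (simp add: dist_commute)
    finally have "u \<in> D" using u(1) closure_subset[of \<Omega>] by (auto simp: D_def)
    from y(2)[OF this] have "d u \<le> d y + (dist u y0 - dist y y0) / M"
      by (simp add: G_def diff_divide_distrib)
    also have "(dist u y0 - dist y y0) / M \<le> (M * d y) / M"
      using M u(2) dist_triangle[of u y0 y] by (intro divide_right_mono) (auto simp: dist_commute)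
    also have "\<dots> = d y" using M by simp
    finally show "dist_bdry \<Omega> u \<le> 2 * dist_bdry \<Omega> y" by (simp add: d_def)
  qed
qed

text \<open>Exponential growth with base \<open>root n 2 > 1\<close> beats linear growth; raising to
  the power \<open>n\<close> gives the claim. The absolute value of \<open>K\<close> makes its sign
  irrelevant.\<close>

lemma exists_power_greater_polynomial:
  fixes K :: real and n :: nat
  assumes "n > 0"
  obtains N where "(K * real (N + 1)) ^ n < 2 ^ N" "N \<ge> 1"
proof -
  have "root n 2 > 1" using assms by simp
  then have "(\<lambda>N. real N / root n 2 ^ N) \<longlonglongrightarrow> 0" by (intro lim_n_over_pown) simp
  moreover have "(\<lambda>N. 1 / root n 2 ^ N) \<longlonglongrightarrow> 0" 
    using \<open>root n 2 > 1\<close> by (rule LIMSEQ_divide_realpow_zero)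
  ultimately have "(\<lambda>N. \<bar>K\<bar> * (real N / root n 2 ^ N + 1 / root n 2 ^ N)) \<longlonglongrightarrow> \<bar>K\<bar> * (0 + 0)"
    by (intro tendsto_intros)
  then have "\<forall>\<^sub>F N in sequentially. \<bar>K\<bar> * (real N / root n 2 ^ N + 1 / root n 2 ^ N) < 1"
    by (rule order_tendstoD) simp
  then have "\<forall>\<^sub>F N in sequentially. \<bar>K\<bar> * (real N / root n 2 ^ N + 1 / root n 2 ^ N) < 1 \<and> N \<ge> 1"
    using eventually_ge_at_top eventually_conj by blast
  then obtain N where N: "\<bar>K\<bar> * (real N / root n 2 ^ N + 1 / root n 2 ^ N) < 1" "N \<ge> 1"
    using eventually_happens'[OF sequentially_bot] by blast
  have "\<bar>K * real (N + 1)\<bar> = \<bar>K\<bar> * (real N + 1)" unfolding abs_mult by simp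
  also have "\<dots> < root n 2 ^ N"
    using N(1) \<open>root n 2 > 1\<close> by (simp add: field_simps flip: add_divide_distrib)
  finally have "\<bar>K * real (N + 1)\<bar> < root n 2 ^ N" .
  then have "\<bar>K * real (N + 1)\<bar> ^ n < (root n 2 ^ N) ^ n" using assms by (intro power_strict_mono) auto
  also have "(root n 2 ^ N) ^ n = 2 ^ N" using assms by (simp flip: power_mult add: mult.commute[of N]) (simp add: power_mult)
  finally have "\<bar>(K * real (N + 1)) ^ n\<bar> < 2 ^ N" by (simp add: power_abs)
  then show thesis using that N(2) by (auto simp: abs_less_iff)
qed

text \<open>The distance is positive on the open set, so the layers inside it decrease to the empty
  set, even if the boundary itself has positive measure.\<close>

lemma measure_bdry_layer_tendsto_0:
  fixes \<Omega> :: "'a::euclidean_space set"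
  assumes "open \<Omega>" "frontier \<Omega> \<noteq> {}"
  shows "(\<lambda>n. measure lborel {y \<in> \<Omega> \<inter> ball c R. dist_bdry \<Omega> y \<le> 1 / real (Suc n)}) \<longlonglongrightarrow> 0"
proof -
  define A where "A n = {y \<in> \<Omega> \<inter> ball c R. dist_bdry \<Omega> y \<le> 1 / real (Suc n)}" for n
  have A_eq: "A n = \<Omega> \<inter> ball c R \<inter> {y. dist_bdry \<Omega> y \<le> 1 / real (Suc n)}" for n
    by (auto simp: A_def)
  have "closed {y. dist_bdry \<Omega> y \<le> t}" for t by (intro closed_Collect_le continuous_intros)
  then have sets: "A n \<in> sets borel" for n unfolding A_eq using assms(1) by auto
  have "(\<lambda>n. measure lborel (A n)) \<longlonglongrightarrow> measure lborel (\<Inter>n. A n)"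
  proof (rule Lim_measure_decseq)
    show "range A \<subseteq> sets lborel" using sets by auto
    show "decseq A" unfolding decseq_def A_def
      by (auto elim!: order_trans simp: frac_le)
    have "bounded (A i)" for i by (rule bounded_subset[OF bounded_ball[of c R]]) (auto simp: A_def)
    then show "emeasure lborel (A i) \<noteq> \<infinity>" for i
      using emeasure_bounded_finite[of "A i"] by auto
  qed
  moreover have "(\<Inter>n. A n) = {}"
  proof (rule ccontr)
    assume "(\<Inter>n. A n) \<noteq> {}"
    then obtain y where y: "\<And>n. y \<in> A n" by blast
    then have "dist_bdry \<Omega> y > 0" using infdist_frontier_pos[OF assms] by (auto simp: A_def)
    then obtain n where "1 / real (Suc n) < dist_bdry \<Omega> y" using nat_approx_posE by blast
    with y[of n] show False by (auto simp: A_def)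
  qed
  ultimately show ?thesis by (simp add: A_def)
qed

section \<open>Measurability and integrability on layers given by a condition on the
  distance\<close>

lemma dist_layer_borel:
  assumes "open \<Omega>" "{t. P t} \<in> sets borel"
  shows "{y \<in> \<Omega> \<inter> ball c R. P (infdist y S)} \<in> sets borel"
proof -
  have "(\<lambda>y. infdist y S) \<in> borel_measurable borel"
    by (intro borel_measurable_continuous_onI continuous_intros)
  from measurable_sets[OF this assms(2)] have "{y. P (infdist y S)} \<in> sets borel"
    by (simp add: vimage_def)
  moreover have "{y \<in> \<Omega> \<inter> ball c R. P (infdist y S)} = \<Omega> \<inter> ball c R \<inter> {y. P (infdist y S)}" by auto
  ultimately show ?thesis using assms(1) by auto
qed

lemma bounded_dist_layer: "bounded {y \<in> \<Omega> \<inter> ball c R. P (infdist y S)}"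
  by (rule bounded_subset[OF bounded_ball[of c R]]) auto

lemma dist_layer_fmeasurable:
  fixes \<Omega> :: "'a::euclidean_space set"
  assumes "open \<Omega>" "{t. P t} \<in> sets borel"
  shows "{y \<in> \<Omega> \<inter> ball c R. P (infdist y S)} \<in> fmeasurable lborel"
  by (rule bounded_borel_fmeasurable[OF dist_layer_borel[OF assms] bounded_dist_layer])

lemma dist_layer_integrable:
  fixes \<Omega> :: "'a::euclidean_space set"
  assumes "open \<Omega>" "{t. P t} \<in> sets borel" "0 < e" "\<And>t. P t \<Longrightarrow> e \<le> t"
  shows "set_integrable lborel {y \<in> \<Omega> \<inter> ball c R. P (infdist y S)} (\<lambda>y. infdist y S powr p)"
  using set_integrable_infdist_powr[OF continuous_on_const[of UNIV 1]
      dist_layer_borel[OF assms(1,2)] bounded_dist_layer assms(3), of c R S S p] assms(4) by simp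

text \<open>A ball is connected: if it met both the set and its complement, it would meet the
  boundary.\<close>

lemma ball_subset_of_le_dist_bdry:
  fixes \<Omega> :: "'a::euclidean_space set"
  assumes "y \<in> \<Omega>"
  shows "ball y (dist_bdry \<Omega> y) \<subseteq> \<Omega>"
proof (rule ccontr)
  assume "\<not> ?thesis"
  then have ne: "ball y (dist_bdry \<Omega> y) - \<Omega> \<noteq> {}" by blast
  then have "y \<in> ball y (dist_bdry \<Omega> y)" by (metis Diff_empty ball_eq_empty centre_in_ball empty_Diff linorder_not_le)
  with assms have "ball y (dist_bdry \<Omega> y) \<inter> \<Omega> \<noteq> {}" by blast
  then have "ball y (dist_bdry \<Omega> y) \<inter> frontier \<Omega> \<noteq> {}"
    using ne by (intro connected_Int_frontier) simp_all
  then show False using ball_infdist_disjoint[of _ y "dist_bdry \<Omega> y" "frontier \<Omega>"] by blast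
qed

text \<open>For \<open>D = 0\<close> the cut-off near the boundary costs nothing in the limit. The radial cut-off is made
  around a point that dominates its neighbourhood, between two radii where the volume at most
  doubles; such radii exist since the volume grows only polynomially.\<close>

lemma hardy_fat_boundary:
  fixes \<Omega> :: "'a::euclidean_space set"
  assumes \<Omega>: "open \<Omega>" and E: "compact E" "E \<subseteq> frontier \<Omega>" "measure lborel E > 0"
    and hardy: "weighted_hardy \<Omega> \<delta> r a" and a: "0 < a" and r: "0 < r"
  shows "2 \<le> a * \<bar>\<delta> - 2\<bar>"
proof (rule ccontr)
  assume "\<not> ?thesis"
  then have a2: "a * \<bar>0 + \<delta> - 2\<bar> < 2" by simp
  have fr: "frontier \<Omega> \<noteq> {}" using E by auto
  let ?n = "DIM('a)"
  define d where "d = dist_bdry \<Omega>"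
  \<comment> \<open>The case \<open>D = 0\<close>: the weight \<open>d powr (- 0)\<close> is 1
    wherever \<open>d\<close> is positive, so these integrals are volumes.\<close>
  obtain C where C: "0 < C"
    "\<And>c R1 R2 \<epsilon>. 0 < R1 \<Longrightarrow> R1 < R2 \<Longrightarrow> 0 < \<epsilon> \<Longrightarrow>
      (\<And>y. y \<in> \<Omega> \<inter> cball c R2 \<Longrightarrow> d y < r) \<Longrightarrow>
      (LINT y:{y \<in> \<Omega> \<inter> ball c R1. 4 * \<epsilon> \<le> d y}|lborel. d y powr (- 0))
      \<le> C * ((LINT y:{y \<in> \<Omega> \<inter> ball c R2. \<epsilon> / 2 \<le> d y \<and> d y \<le> 4 * \<epsilon>}|lborel. d y powr (- 0))
            + (LINT y:{y \<in> \<Omega> \<inter> ball c R2. \<epsilon> / 2 \<le> d y}|lborel. d y powr (2 - 0)) / (R2 - R1)\<^sup>2)"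
    using hardy_caccioppoli[OF \<Omega> fr hardy a a2] unfolding d_def by blast
  \<comment> \<open>The radial cut-off will act over a width of \<open>K * \<tau>\<close>;
    \<open>16 * C \<le> K^2\<close> makes its cost at most half of the volume on the left.\<close>
  define K where "K = 1 + 16 * C"
  have K: "K \<ge> 1" "16 * C \<le> K\<^sup>2"
    using C(1) by (auto simp: K_def power2_eq_square algebra_simps)
  obtain N where N: "(K * real (N + 1)) ^ ?n < 2 ^ N" "N \<ge> 1"
    using exists_power_greater_polynomial[OF DIM_positive] by blast
  define M where "M = K * real (N + 1)"
  have "M \<ge> 1 * 1" unfolding M_def using K by (intro mult_mono) auto
  then have "M \<ge> 1" by simp
  obtain y where y: "y \<in> \<Omega>" "d y < r / 2" "\<And>u. u \<in> \<Omega> \<inter> cball y (M * d y) \<Longrightarrow> d u \<le> 2 * d y"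
    using exists_point_dominating_dist[OF \<Omega> E \<open>M \<ge> 1\<close>, of "r / 2"] r unfolding d_def by auto
  define \<tau> where "\<tau> = d y"
  have \<tau>: "\<tau> > 0" unfolding \<tau>_def d_def using infdist_frontier_pos[OF \<Omega> fr y(1)] .
  define w where "w j = measure lborel (\<Omega> \<inter> ball y (K * real j * \<tau>))" for j
  have ball_meas: "\<Omega> \<inter> ball y t \<in> fmeasurable lborel" for t
    using \<Omega> by (intro bounded_borel_fmeasurable) auto
  define \<omega> where "\<omega> = unit_ball_vol (real ?n)"
  have vol: "measure lborel (ball y t) = \<omega> * t ^ ?n" if "t \<ge> 0" for t
    using that by (simp add: content_ball \<omega>_def)
  have \<omega>: "\<omega> > 0" by (simp add: \<omega>_def)
  have "\<omega> * \<tau> ^ ?n \<le> w 1"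
  proof -
    have "\<omega> * \<tau> ^ ?n = measure lborel (ball y \<tau>)" using vol \<tau> by simp
    also have "\<dots> \<le> w 1" unfolding w_def
    proof (rule fmeasurable_measure_mono)
      have "\<tau> \<le> K * real 1 * \<tau>" using K \<tau> by simp
      then show "ball y \<tau> \<subseteq> \<Omega> \<inter> ball y (K * real 1 * \<tau>)"
        using ball_subset_of_le_dist_bdry[OF y(1)] by (auto simp: \<tau>_def d_def)
    qed (use ball_meas in \<open>auto intro!: bounded_borel_fmeasurable\<close>)
    finally show ?thesis .
  qed
  then have w1: "w 1 > 0" using \<omega> \<tau> by (meson less_le_trans mult_pos_pos zero_less_power)
  \<comment> \<open>If the volume more than doubled at each of the \<open>N\<close> steps, it would
    exceed \<open>2 ^ N * w 1\<close>. But it is at most \<open>M ^ ?n * w 1\<close>, because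
    \<open>w 1\<close> already contains a full ball of radius \<tau>, and \<open>N\<close> was
    chosen to rule this out.\<close>
  have "\<exists>j. 1 \<le> j \<and> j \<le> N \<and> w (j + 1) \<le> 2 * w j"
  proof (rule ccontr)
    assume "\<not> ?thesis"
    then have dbl: "2 * w j < w (j + 1)" if "1 \<le> j" "j \<le> N" for j
      using that by (meson linorder_not_le)
    have "2 ^ i * w 1 \<le> w (i + 1)" if "i \<le> N" for i
      using that
    proof (induction i)
      case (Suc i)
      then have "2 ^ Suc i * w 1 \<le> 2 * w (i + 1)" by simp
      also have "\<dots> \<le> w (Suc i + 1)" using dbl[of "i + 1"] Suc.prems by simp
      finally show ?case .
    qed simp
    then have "2 ^ N * w 1 \<le> w (N + 1)" by blast
    also have "\<dots> \<le> measure lborel (ball y (M * \<tau>))"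
      unfolding w_def M_def using ball_meas \<Omega>
      by (intro fmeasurable_measure_mono bounded_borel_fmeasurable) auto
    also have "\<dots> = M ^ ?n * (\<omega> * \<tau> ^ ?n)"
      using vol[of "M * \<tau>"] \<open>M \<ge> 1\<close> \<tau> by (simp add: power_mult_distrib)
    also have "\<dots> \<le> M ^ ?n * w 1" using \<open>_ \<le> w 1\<close> \<open>M \<ge> 1\<close> by (intro mult_left_mono) auto
    also have "\<dots> < 2 ^ N * w 1" using N(1) w1 by (simp add: M_def)
    finally show False by simp
  qed
  then obtain j where j: "1 \<le> j" "j \<le> N" "w (j + 1) \<le> 2 * w j" by blast
  define R1 where "R1 = K * real j * \<tau>"
  define R2 where "R2 = K * real (j + 1) * \<tau>"
  have R: "0 < R1" "R1 < R2" "R2 - R1 = K * \<tau>"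
    using K \<tau> j by (auto simp: R1_def R2_def algebra_simps)
  have dom: "d u \<le> 2 * \<tau>" if "u \<in> \<Omega> \<inter> cball y R2" for u
  proof -
    have "R2 \<le> M * \<tau>" unfolding R2_def M_def using j K \<tau> by (intro mult_mono) auto
    with that y(3)[of u] show ?thesis by (auto simp: \<tau>_def)
  qed
  have dpos: "d u > 0" if "u \<in> \<Omega>" for u
    using infdist_frontier_pos[OF \<Omega> fr that] by (simp add: d_def)
  define m where "m e = measure lborel {u \<in> \<Omega> \<inter> ball y R2. d u \<le> e}" for e
  have wj: "w j = measure lborel (\<Omega> \<inter> ball y R1)" "w (j + 1) = measure lborel (\<Omega> \<inter> ball y R2)"
    by (simp_all only: w_def R1_def R2_def)
  have bound: "w j / 2 \<le> (1 + C) * m (4 * \<epsilon>)" if \<epsilon>: "\<epsilon> > 0" for \<epsilon>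
  proof -
    define S1 where "S1 = {u \<in> \<Omega> \<inter> ball y R1. 4 * \<epsilon> \<le> d u}"
    define S2 where "S2 = {u \<in> \<Omega> \<inter> ball y R2. \<epsilon> / 2 \<le> d u \<and> d u \<le> 4 * \<epsilon>}"
    define S3 where "S3 = {u \<in> \<Omega> \<inter> ball y R2. \<epsilon> / 2 \<le> d u}"
    define S4 where "S4 = {u \<in> \<Omega> \<inter> ball y R2. d u \<le> 4 * \<epsilon>}"
    have meas: "S1 \<in> fmeasurable lborel" "S2 \<in> fmeasurable lborel" "S3 \<in> fmeasurable lborel"
      "S4 \<in> fmeasurable lborel"
      unfolding S1_def S2_def S3_def S4_def d_def by (rule dist_layer_fmeasurable[OF \<Omega>]; measurable)+
    have int1: "set_integrable lborel S1 (\<lambda>u. d u powr p)" for p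
      unfolding S1_def d_def
      by (rule dist_layer_integrable[OF \<Omega>, where e = "4 * \<epsilon>"]) (use \<epsilon> in \<open>auto, measurable\<close>)
    have int2: "set_integrable lborel S2 (\<lambda>u. d u powr p)" for p
      unfolding S2_def d_def
      by (rule dist_layer_integrable[OF \<Omega>, where e = "\<epsilon> / 2"]) (use \<epsilon> in \<open>auto, measurable\<close>)
    have int3: "set_integrable lborel S3 (\<lambda>u. d u powr p)" for p
      unfolding S3_def d_def
      by (rule dist_layer_integrable[OF \<Omega>, where e = "\<epsilon> / 2"]) (use \<epsilon> in \<open>auto, measurable\<close>)
    have "(LINT u:S1|lborel. d u powr (- 0)) \<le> C * ((LINT u:S2|lborel. d u powr (- 0))
          + (LINT u:S3|lborel. d u powr (2 - 0)) / (R2 - R1)\<^sup>2)"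
      unfolding S1_def S2_def S3_def
    proof (rule C(2)[OF R(1,2) \<epsilon>])
      fix u assume "u \<in> \<Omega> \<inter> cball y R2"
      then show "d u < r" using dom[of u] y(2) by (simp add: \<tau>_def)
    qed
    moreover have "w j - m (4 * \<epsilon>) \<le> (LINT u:S1|lborel. d u powr (- 0))"
    proof -
      have "w j \<le> measure lborel (S1 \<union> S4)"
        unfolding wj using meas ball_meas R
        by (intro fmeasurable_measure_mono fmeasurable.Un) (auto simp: S1_def S4_def)
      also have "\<dots> \<le> measure lborel S1 + m (4 * \<epsilon>)"
        using measure_Un_le[OF fmeasurableD[OF meas(1)] fmeasurableD[OF meas(4)]]
        by (simp only: m_def S4_def)
      finally have "w j - m (4 * \<epsilon>) \<le> 1 * measure lborel S1" by simp
      also have "\<dots> \<le> (LINT u:S1|lborel. d u powr (- 0))"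
        by (rule set_integral_const_le[OF meas(1) int1]) (use \<epsilon> in \<open>auto simp: S1_def\<close>)
      finally show ?thesis .
    qed
    moreover have "(LINT u:S2|lborel. d u powr (- 0)) \<le> m (4 * \<epsilon>)"
    proof -
      have "(LINT u:S2|lborel. d u powr (- 0)) \<le> 1 * measure lborel S2"
        by (rule set_integral_le_const[OF meas(2) int2]) auto
      also have "\<dots> \<le> m (4 * \<epsilon>)"
        unfolding m_def mult_1_left using meas
        by (intro fmeasurable_measure_mono) (auto simp: S2_def S4_def)
      finally show ?thesis .
    qed
    \<comment> \<open>Domination gives \<open>d \<le> 2 * \<tau>\<close>, the volume at most
      doubles, and the width is \<open>K * \<tau>\<close>; the factor \<open>\<tau>^2\<close>
      cancels.\<close>
    moreover have "(LINT u:S3|lborel. d u powr (2 - 0)) / (R2 - R1)\<^sup>2 \<le> 8 * w j / K\<^sup>2"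
    proof -
      have "(LINT u:S3|lborel. d u powr (2 - 0)) \<le> (2 * \<tau>)\<^sup>2 * measure lborel S3"
      proof (rule set_integral_le_const[OF meas(3) int3])
        fix u assume "u \<in> S3"
        then have "0 < d u" "d u \<le> 2 * \<tau>" using dom[of u] dpos[of u] by (auto simp: S3_def)
        then show "d u powr (2 - 0) \<le> (2 * \<tau>)\<^sup>2" using power_mono[of "d u" "2 * \<tau>" 2] by simp
      qed
      also have "\<dots> \<le> (2 * \<tau>)\<^sup>2 * (2 * w j)"
      proof (intro mult_left_mono)
        have "measure lborel S3 \<le> w (j + 1)"
          unfolding wj using meas ball_meas by (intro fmeasurable_measure_mono) (auto simp: S3_def)
        with j(3) show "measure lborel S3 \<le> 2 * w j" by simp
      qed simp
      finally have "(LINT u:S3|lborel. d u powr (2 - 0)) / (R2 - R1)\<^sup>2 \<le> (2 * \<tau>)\<^sup>2 * (2 * w j) / (R2 - R1)\<^sup>2"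
        by (rule divide_right_mono) simp
      also have "\<dots> = 8 * w j / K\<^sup>2" unfolding R(3) using \<tau> by (simp add: power_mult_distrib)
      finally show ?thesis .
    qed
    ultimately have "w j - m (4 * \<epsilon>) \<le> C * (m (4 * \<epsilon>) + 8 * w j / K\<^sup>2)"
      using C(1) by (meson add_mono mult_left_mono less_imp_le order_trans)
    also have "C * (m (4 * \<epsilon>) + 8 * w j / K\<^sup>2) \<le> C * m (4 * \<epsilon>) + w j / 2"
    proof -
      have "(16 * C) * w j \<le> K\<^sup>2 * w j" using K by (intro mult_right_mono) (auto simp: w_def)
      then have "C * (8 * w j / K\<^sup>2) \<le> w j / 2" using K by (simp add: field_simps)
      then show ?thesis by (simp add: distrib_left)
    qed
    finally show ?thesis by (simp add: algebra_simps)
  qed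
  \<comment> \<open>The right hand side of \<open>bound\<close> vanishes in the limit, while
    \<open>w j \<ge> w 1 > 0\<close> does not depend on \<epsilon>.\<close>
  have "(\<lambda>n. (1 + C) * m (1 / real (Suc n))) \<longlonglongrightarrow> (1 + C) * 0"
    unfolding m_def d_def by (intro tendsto_mult_left measure_bdry_layer_tendsto_0 \<Omega> fr)
  moreover have "w j / 2 \<le> (1 + C) * m (1 / real (Suc n))" for n
  proof -
    have "4 * (t / 4) = t" for t :: real by simp
    then show ?thesis using bound[of "1 / real (Suc n) / 4"] by (metis divide_pos_pos of_nat_0_less_iff zero_less_Suc zero_less_numeral zero_less_one)
  qed
  ultimately have "w j / 2 \<le> (1 + C) * 0" by (intro LIMSEQ_le_const) auto
  moreover have "w 1 \<le> w j"
  proof -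
    have "K * real 1 * \<tau> \<le> K * real j * \<tau>" using j K \<tau> by (intro mult_mono) auto
    then have "ball y (K * real 1 * \<tau>) \<subseteq> ball y (K * real j * \<tau>)" by (rule subset_ball)
    then show ?thesis unfolding w_def by (intro fmeasurable_measure_mono ball_meas) blast
  qed
  ultimately show False using w1 by simp
qed

section \<open>Ahlfors points\<close>

text \<open>For \<open>D > 0\<close> every shell \<open>t / M \<le> d < t\<close> contributes a fixed amount to the integral of \<open>d powr - D\<close>,
  which therefore diverges, while the two error terms stay bounded.\<close>

lemma hardy_thin_boundary:
  fixes \<Omega> :: "'a::euclidean_space set"
  assumes \<Omega>: "open \<Omega>" "frontier \<Omega> \<noteq> {}"
    and hardy: "weighted_hardy \<Omega> \<delta> r a" and a: "0 < a" and D: "0 < D"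
    and R: "0 < R1" "R1 < R2" and layer: "\<And>y. y \<in> \<Omega> \<inter> cball x R2 \<Longrightarrow> dist_bdry \<Omega> y < r"
    and \<kappa>: "0 < \<kappa>" "0 < \<kappa>'" "0 < t\<^sub>0"
    and lower: "\<And>t. 0 < t \<Longrightarrow> t < t\<^sub>0 \<Longrightarrow>
      \<kappa>' * t powr D \<le> measure lborel {y \<in> \<Omega> \<inter> ball x R1. dist_bdry \<Omega> y < t}"
    and upper: "\<And>t. 0 < t \<Longrightarrow> t < t\<^sub>0 \<Longrightarrow>
      measure lborel {y \<in> \<Omega> \<inter> ball x R2. dist_bdry \<Omega> y < t} \<le> \<kappa> * t powr D"
  shows "2 \<le> a * \<bar>D + \<delta> - 2\<bar>"
proof (rule ccontr)
  assume "\<not> ?thesis"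
  then have a2: "a * \<bar>D + \<delta> - 2\<bar> < 2" by simp
  define d where "d = dist_bdry \<Omega>"
  obtain C where C: "0 < C"
    "\<And>c R1 R2 \<epsilon>. 0 < R1 \<Longrightarrow> R1 < R2 \<Longrightarrow> 0 < \<epsilon> \<Longrightarrow>
      (\<And>y. y \<in> \<Omega> \<inter> cball c R2 \<Longrightarrow> d y < r) \<Longrightarrow>
      (LINT y:{y \<in> \<Omega> \<inter> ball c R1. 4 * \<epsilon> \<le> d y}|lborel. d y powr (- D))
      \<le> C * ((LINT y:{y \<in> \<Omega> \<inter> ball c R2. \<epsilon> / 2 \<le> d y \<and> d y \<le> 4 * \<epsilon>}|lborel. d y powr (- D))
            + (LINT y:{y \<in> \<Omega> \<inter> ball c R2. \<epsilon> / 2 \<le> d y}|lborel. d y powr (2 - D)) / (R2 - R1)\<^sup>2)"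
    using hardy_caccioppoli[OF \<Omega> hardy a a2] unfolding d_def by blast
  have meas: "{y \<in> \<Omega> \<inter> ball x R. P (d y)} \<in> fmeasurable lborel" if "{t. P t} \<in> sets borel" for R P
    unfolding d_def by (rule dist_layer_fmeasurable[OF \<Omega>(1) that])
  have int: "set_integrable lborel {y \<in> \<Omega> \<inter> ball x R. P (d y)} (\<lambda>y. d y powr p)"
    if "{t. P t} \<in> sets borel" "0 < e" "\<And>t. P t \<Longrightarrow> e \<le> t" for R P p e
    unfolding d_def by (rule dist_layer_integrable[OF \<Omega>(1) that])
  have split: "(LINT y:{y \<in> \<Omega> \<inter> ball x R. s \<le> d y}|lborel. d y powr p)
      = (LINT y:{y \<in> \<Omega> \<inter> ball x R. t \<le> d y}|lborel. d y powr p)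
        + (LINT y:{y \<in> \<Omega> \<inter> ball x R. s \<le> d y \<and> d y < t}|lborel. d y powr p)"
    if st: "0 < s" "s \<le> t" for R s t p
  proof -
    have eq: "{y \<in> \<Omega> \<inter> ball x R. s \<le> d y} =
        {y \<in> \<Omega> \<inter> ball x R. t \<le> d y} \<union> {y \<in> \<Omega> \<inter> ball x R. s \<le> d y \<and> d y < t}"
      using st by auto
    show ?thesis unfolding eq
    proof (rule set_integral_Un)
      show "set_integrable lborel {y \<in> \<Omega> \<inter> ball x R. t \<le> d y} (\<lambda>y. d y powr p)"
        by (rule int[where e = s]) (use st in \<open>auto, measurable\<close>)
      show "set_integrable lborel {y \<in> \<Omega> \<inter> ball x R. s \<le> d y \<and> d y < t} (\<lambda>y. d y powr p)"
        by (rule int[where e = s]) (use st in \<open>auto, measurable\<close>)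
    qed auto
  qed
  define m1 where "m1 t = measure lborel {y \<in> \<Omega> \<inter> ball x R1. d y < t}" for t
  define m2 where "m2 t = measure lborel {y \<in> \<Omega> \<inter> ball x R2. d y < t}" for t
  have m12: "m1 t \<le> m2 t" for t
    unfolding m1_def m2_def
  proof (rule fmeasurable_measure_mono)
    show "{y \<in> \<Omega> \<inter> ball x R1. d y < t} \<in> fmeasurable lborel" by (rule meas) measurable
    show "{y \<in> \<Omega> \<inter> ball x R2. d y < t} \<in> fmeasurable lborel" by (rule meas) measurable
  qed (use R in auto)
  define L where "L t = (LINT y:{y \<in> \<Omega> \<inter> ball x R1. t \<le> d y}|lborel. d y powr (- D))" for t
  define J where "J t = (LINT y:{y \<in> \<Omega> \<inter> ball x R2. t \<le> d y}|lborel. d y powr (2 - D))" for t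
  \<comment> \<open>With this ratio the upper bound for the layer \<open>d < t / M\<close> is at
    most half of the lower bound for the layer \<open>d < t\<close>, so the shell between them keeps
    a definite volume.\<close>
  define M where "M = max 2 ((2 * \<kappa> / \<kappa>') powr (1 / D))"
  have M: "M \<ge> 2" by (simp add: M_def)
  have MD: "2 * \<kappa> \<le> \<kappa>' * M powr D"
  proof -
    have "2 * \<kappa> / \<kappa>' = ((2 * \<kappa> / \<kappa>') powr (1 / D)) powr D" using \<kappa> D by (simp add: powr_powr)
    also have "\<dots> \<le> M powr D" using D by (intro powr_mono2) (auto simp: M_def)
    finally show ?thesis using \<kappa> by (simp add: field_simps)
  qed
  \<comment> \<open>The contribution of one shell: at least \<open>t powr (- D)\<close> on a volume
    of at least \<open>\<kappa> * (t / M) powr D\<close>, independent of \<open>t\<close>.\<close>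
  define c0 where "c0 = \<kappa> * M powr (- D)"
  have c0: "c0 > 0" using \<kappa> M by (simp add: c0_def)
  have L_step: "L t + c0 \<le> L (t / M)" if t: "0 < t" "t < t\<^sub>0" for t
  proof -
    define S where "S = {y \<in> \<Omega> \<inter> ball x R1. t / M \<le> d y \<and> d y < t}"
    have tM: "0 < t / M" "t / M \<le> t" using t M by (auto simp: field_simps)
    have tMD: "(t / M) powr D = t powr D * M powr (- D)"
      using t M by (simp add: powr_divide powr_minus_divide)
    have S_meas: "S \<in> fmeasurable lborel" unfolding S_def by (rule meas) measurable
    have T_meas: "{y \<in> \<Omega> \<inter> ball x R1. d y < t / M} \<in> fmeasurable lborel" by (rule meas) measurable
    have "\<kappa> * (t / M) powr D \<le> measure lborel S"
    proof -
      have "m1 t \<le> measure lborel (S \<union> {y \<in> \<Omega> \<inter> ball x R1. d y < t / M})"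
        unfolding m1_def
      proof (rule fmeasurable_measure_mono)
        show "{y \<in> \<Omega> \<inter> ball x R1. d y < t} \<in> fmeasurable lborel" by (rule meas) measurable
        show "S \<union> {y \<in> \<Omega> \<inter> ball x R1. d y < t / M} \<in> fmeasurable lborel"
          by (rule fmeasurable.Un[OF S_meas T_meas])
      qed (auto simp: S_def)
      also have "\<dots> \<le> measure lborel S + m1 (t / M)"
        unfolding m1_def by (intro measure_Un_le fmeasurableD S_meas T_meas)
      finally have "m1 t \<le> measure lborel S + m1 (t / M)" .
      moreover have "\<kappa>' * t powr D \<le> m1 t" using lower[OF t] by (simp add: m1_def d_def)
      moreover have "m1 (t / M) \<le> \<kappa> * (t / M) powr D"
        using m12[of "t / M"] upper[of "t / M"] tM t by (simp add: m2_def d_def)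
      moreover have "2 * (\<kappa> * (t / M) powr D) \<le> \<kappa>' * t powr D"
      proof -
        have "2 * \<kappa> * (t / M) powr D \<le> \<kappa>' * M powr D * (t / M) powr D"
          using MD by (intro mult_right_mono) auto
        also have "\<dots> = \<kappa>' * t powr D" unfolding tMD using M by (simp add: powr_minus)
        finally show ?thesis by simp
      qed
      ultimately show ?thesis by linarith
    qed
    then have "t powr (- D) * (\<kappa> * (t / M) powr D) \<le> t powr (- D) * measure lborel S"
      by (intro mult_left_mono) auto
    also have "\<dots> \<le> (LINT y:S|lborel. d y powr (- D))"
    proof (rule set_integral_const_le[OF S_meas])
      show "set_integrable lborel S (\<lambda>y. d y powr - D)"
        unfolding S_def by (rule int[where e = "t / M"]) (use tM in \<open>auto, measurable\<close>)
      show "t powr - D \<le> d y powr - D" if "y \<in> S" for y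
        using that tM D by (intro powr_mono2') (auto simp: S_def)
    qed
    also have "t powr (- D) * (\<kappa> * (t / M) powr D) = c0"
      unfolding tMD c0_def using t by (simp add: powr_minus)
    finally show ?thesis unfolding L_def split[OF tM] S_def by simp
  qed
  define t1 where "t1 = t\<^sub>0 / 2"
  have t1: "0 < t1" "t1 < t\<^sub>0" using \<kappa> by (auto simp: t1_def)
  have div_le: "t1 / s ^ n \<le> t1" if "s \<ge> 1" for s :: real and n
    using t1 that by (simp add: divide_le_eq_1 field_simps)
  have L_lower: "real n * c0 \<le> L (t1 / M ^ n)" for n
  proof (induction n)
    case 0
    show ?case unfolding L_def set_lebesgue_integral_def by (auto intro!: integral_nonneg_AE)
  next
    case (Suc n)
    have "L (t1 / M ^ n) + c0 \<le> L (t1 / M ^ n / M)"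
      using div_le[of M n] M t1 by (intro L_step) auto
    with Suc show ?case by (simp add: algebra_simps)
  qed
  define B where "B = \<kappa> * 2 powr D"
  have B: "B \<ge> 0" using \<kappa> by (simp add: B_def)
  have J_step: "J (t / 2) \<le> J t + B * t\<^sup>2" if t: "0 < t" "t < t\<^sub>0" for t
  proof -
    define S where "S = {y \<in> \<Omega> \<inter> ball x R2. t / 2 \<le> d y \<and> d y < t}"
    have S_meas: "S \<in> fmeasurable lborel" unfolding S_def by (rule meas) measurable
    have "(LINT y:S|lborel. d y powr (2 - D)) \<le> (t\<^sup>2 * (t / 2) powr (- D)) * measure lborel S"
    proof (rule set_integral_le_const[OF S_meas])
      show "set_integrable lborel S (\<lambda>y. d y powr (2 - D))"
        unfolding S_def by (rule int[where e = "t / 2"]) (use t in \<open>auto, measurable\<close>)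
      fix y assume y: "y \<in> S"
      then have dy: "0 < d y" "t / 2 \<le> d y" "d y < t" using t by (auto simp: S_def)
      \<comment> \<open>The sign of \<open>2 - D\<close> is unknown, so the two factors are bounded
        separately.\<close>
      have "d y powr (2 - D) = (d y)\<^sup>2 * d y powr (- D)"
        using dy by (simp add: powr_diff powr_minus_divide)
      also have "\<dots> \<le> t\<^sup>2 * (t / 2) powr (- D)"
        using dy t D by (intro mult_mono power_mono powr_mono2') auto
      finally show "d y powr (2 - D) \<le> t\<^sup>2 * (t / 2) powr (- D)" .
    qed
    also have "\<dots> \<le> (t\<^sup>2 * (t / 2) powr (- D)) * (\<kappa> * t powr D)"
    proof (intro mult_left_mono)
      have "measure lborel S \<le> m2 t"
        unfolding m2_def
      proof (rule fmeasurable_measure_mono[OF S_meas])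
        show "{y \<in> \<Omega> \<inter> ball x R2. d y < t} \<in> fmeasurable lborel" by (rule meas) measurable
      qed (auto simp: S_def)
      also have "\<dots> \<le> \<kappa> * t powr D" using upper[OF t] by (simp add: m2_def d_def)
      finally show "measure lborel S \<le> \<kappa> * t powr D" .
    qed auto
    also have "\<dots> = B * t\<^sup>2"
      using t by (simp add: B_def powr_divide powr_minus_divide)
    finally show ?thesis
      using split[of "t / 2" t R2 "2 - D"] t by (simp add: J_def S_def)
  qed
  define J0 where "J0 = J t1 + 2 * B * t1\<^sup>2"
  \<comment> \<open>The dyadic increments carry \<open>1 / 4 ^ i\<close>; the cruder
    \<open>1 / 2 ^ i\<close> has the partial sums \<open>2 - 2 / 2 ^ n\<close>.\<close>
  have J_pow: "J (t1 / 2 ^ n) \<le> J t1 + B * t1\<^sup>2 * (2 - 2 / 2 ^ n)" for n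
  proof (induction n)
    case (Suc n)
    have "J (t1 / 2 ^ n / 2) \<le> J (t1 / 2 ^ n) + B * (t1 / 2 ^ n)\<^sup>2"
      using div_le[of 2 n] t1 by (intro J_step) auto
    also have "B * (t1 / 2 ^ n)\<^sup>2 \<le> B * t1\<^sup>2 * (1 / 2 ^ n)"
    proof -
      have "(1 / 2 ^ n)\<^sup>2 \<le> (1 / 2 ^ n :: real)"
        by (simp add: power2_eq_square divide_le_eq_1 field_simps)
      then have "B * t1\<^sup>2 * (1 / 2 ^ n)\<^sup>2 \<le> B * t1\<^sup>2 * (1 / 2 ^ n)"
        using B by (intro mult_left_mono) auto
      then show ?thesis by (simp add: power_divide)
    qed
    also note Suc
    finally show ?case by (simp add: field_simps)
  qed simp
  have J_le: "J e \<le> J0" if e: "0 < e" "e \<le> t1" for e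
  proof -
    obtain n where n: "t1 / 2 ^ n < e"
      using real_arch_pow_inv[of "e / t1" "1/2"] e t1 by (auto simp: power_divide field_simps)
    have "J e \<le> J (t1 / 2 ^ n)"
      unfolding J_def
    proof (rule set_integral_mono_subset)
      show "set_integrable lborel {y \<in> \<Omega> \<inter> ball x R2. t1 / 2 ^ n \<le> d y} (\<lambda>y. d y powr (2 - D))"
        by (rule int[where e = "t1 / 2 ^ n"]) (use t1 in \<open>auto, measurable\<close>)
      show "{y \<in> \<Omega> \<inter> ball x R2. e \<le> d y} \<in> sets lborel"
        by (rule fmeasurableD, rule meas) measurable
    qed (use n in auto)
    also have "\<dots> \<le> J0"
    proof -
      have "B * t1\<^sup>2 * (2 - 2 / 2 ^ n) \<le> B * t1\<^sup>2 * 2" using B by (intro mult_left_mono) auto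
      then show ?thesis using J_pow[of n] by (simp add: J0_def)
    qed
    finally show ?thesis .
  qed
  define Q where "Q = C * (\<kappa> * 10 powr D + J0 / (R2 - R1)\<^sup>2)"
  have "L (t1 / M ^ n) \<le> Q" for n
  proof -
    \<comment> \<open>Thus \<open>4 * \<epsilon>\<close> is the threshold in \<open>L_lower\<close>.
      The shell is closed at \<open>4 * \<epsilon>\<close> but the volume bound concerns strict
      inequality, whence \<open>5 * \<epsilon>\<close> below.\<close>
    define \<epsilon> where "\<epsilon> = t1 / M ^ n / 4"
    have \<epsilon>: "0 < \<epsilon>" "4 * \<epsilon> = t1 / M ^ n" "4 * \<epsilon> \<le> t1"
      using t1 M div_le[of M n] by (auto simp: \<epsilon>_def)
    have \<epsilon>5: "5 * \<epsilon> < t\<^sub>0" using \<epsilon>(3) t1 unfolding t1_def by linarith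
    define S where "S = {y \<in> \<Omega> \<inter> ball x R2. \<epsilon> / 2 \<le> d y \<and> d y \<le> 4 * \<epsilon>}"
    have S_meas: "S \<in> fmeasurable lborel" unfolding S_def by (rule meas) measurable
    have "(LINT y:S|lborel. d y powr (- D)) \<le> (\<epsilon> / 2) powr (- D) * measure lborel S"
    proof (rule set_integral_le_const[OF S_meas])
      show "set_integrable lborel S (\<lambda>y. d y powr (- D))"
        unfolding S_def by (rule int[where e = "\<epsilon> / 2"]) (use \<epsilon> in \<open>auto, measurable\<close>)
      show "d y powr (- D) \<le> (\<epsilon> / 2) powr (- D)" if "y \<in> S" for y
        using that \<epsilon> D by (intro powr_mono2') (auto simp: S_def)
    qed
    also have "\<dots> \<le> (\<epsilon> / 2) powr (- D) * (\<kappa> * (5 * \<epsilon>) powr D)"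
    proof (intro mult_left_mono)
      have "measure lborel S \<le> m2 (5 * \<epsilon>)"
        unfolding m2_def
      proof (rule fmeasurable_measure_mono[OF S_meas])
        show "{y \<in> \<Omega> \<inter> ball x R2. d y < 5 * \<epsilon>} \<in> fmeasurable lborel" by (rule meas) measurable
      qed (use \<epsilon> in \<open>auto simp: S_def\<close>)
      also have "\<dots> \<le> \<kappa> * (5 * \<epsilon>) powr D" using upper[of "5 * \<epsilon>"] \<epsilon> \<epsilon>5 by (simp add: m2_def d_def)
      finally show "measure lborel S \<le> \<kappa> * (5 * \<epsilon>) powr D" .
    qed auto
    also have "\<dots> = \<kappa> * 10 powr D"
    proof -
      have "(5 * \<epsilon>) powr D = 10 powr D * (\<epsilon> / 2) powr D"
        using \<epsilon> by (simp flip: powr_mult)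
      then show ?thesis using \<epsilon> by (simp add: powr_minus)
    qed
    finally have "(LINT y:S|lborel. d y powr (- D)) \<le> \<kappa> * 10 powr D" .
    moreover have "J (\<epsilon> / 2) / (R2 - R1)\<^sup>2 \<le> J0 / (R2 - R1)\<^sup>2"
      using J_le[of "\<epsilon> / 2"] \<epsilon> by (intro divide_right_mono) auto
    ultimately have "C * ((LINT y:S|lborel. d y powr (- D)) + J (\<epsilon> / 2) / (R2 - R1)\<^sup>2) \<le> Q"
      unfolding Q_def using C(1) by (intro mult_left_mono add_mono) auto
    moreover have "L (4 * \<epsilon>) \<le> C * ((LINT y:S|lborel. d y powr (- D)) + J (\<epsilon> / 2) / (R2 - R1)\<^sup>2)"
      unfolding L_def J_def S_def by (rule C(2)[OF R \<epsilon>(1)]) (simp add: d_def layer)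
    ultimately show ?thesis by (simp add: \<epsilon>(2))
  qed
  \<comment> \<open>Logarithmic divergence against a bound independent of \<open>n\<close>.\<close>
  then have "real n * c0 \<le> Q" for n using L_lower[of n] order_trans by blast
  moreover obtain n where "Q / c0 < real n" using reals_Archimedean2 by blast
  ultimately show False using c0 by (simp add: field_simps) (metis linorder_not_le mult.commute)
qed

text \<open>Explicit thresholds replace the filters, and Borel measurability of the neighbourhoods
  allows the change from \<open>lebesgue\<close> to \<open>lborel\<close>.\<close>

lemma ahlfors_pointE:
  fixes \<Omega> :: "'a::euclidean_space set"
  assumes "ahlfors_point \<Omega> x d\<^sub>H"
  obtains s\<^sub>0 where "0 < s\<^sub>0"
    "\<And>s. 0 < s \<Longrightarrow> s < s\<^sub>0 \<Longrightarrow> \<exists>\<kappa>>0. \<exists>\<kappa>'>0. \<exists>t\<^sub>0>0. \<forall>t. 0 < t \<longrightarrow> t < t\<^sub>0 \<longrightarrow>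
      \<kappa>' * t powr (real DIM('a) - d\<^sub>H) \<le> measure lborel (inner_nbhd \<Omega> (frontier \<Omega> \<inter> ball x s) t) \<and>
      measure lborel (inner_nbhd \<Omega> (frontier \<Omega> \<inter> ball x s) t) \<le> \<kappa> * t powr (real DIM('a) - d\<^sub>H)"
proof -
  have x: "x \<in> frontier \<Omega>" using assms by (simp add: ahlfors_point_def)
  define P where "P s \<longleftrightarrow> (\<exists>\<kappa>>0. \<exists>\<kappa>'>0. \<forall>\<^sub>F r in at_right 0.
          \<kappa>' * r powr (real DIM('a) - d\<^sub>H)
            \<le> measure lebesgue (inner_nbhd \<Omega> (frontier \<Omega> \<inter> ball x s) r) \<and>
          measure lebesgue (inner_nbhd \<Omega> (frontier \<Omega> \<inter> ball x s) r)
            \<le> \<kappa> * r powr (real DIM('a) - d\<^sub>H))" for s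
  from assms have "\<forall>\<^sub>F s in at_right 0. hausdorff_dim (frontier \<Omega> \<inter> ball x s) = d\<^sub>H \<and> P s"
    unfolding ahlfors_point_def P_def by (rule conjunct2)
  then have "\<forall>\<^sub>F s in at_right 0. P s" by (rule eventually_mono) (rule conjunct2)
  then obtain s\<^sub>0 where s0: "0 < s\<^sub>0" "\<And>s. 0 < s \<Longrightarrow> s < s\<^sub>0 \<Longrightarrow> P s"
    unfolding eventually_at_right_field by blast
  show thesis
  proof (rule that[OF s0(1)])
    fix s assume s: "0 < s" "s < s\<^sub>0"
    have "frontier \<Omega> \<inter> ball x s \<noteq> {}" using x s by auto
    then have "inner_nbhd \<Omega> (frontier \<Omega> \<inter> ball x s) t \<in> sets lborel" for t
      by (intro fmeasurableD inner_nbhd_fmeasurable) auto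
    then have "measure lebesgue (inner_nbhd \<Omega> (frontier \<Omega> \<inter> ball x s) t)
        = measure lborel (inner_nbhd \<Omega> (frontier \<Omega> \<inter> ball x s) t)" for t
      by (rule measure_completion)
    with s0(2)[OF s] show "\<exists>\<kappa>>0. \<exists>\<kappa>'>0. \<exists>t\<^sub>0>0. \<forall>t. 0 < t \<longrightarrow> t < t\<^sub>0 \<longrightarrow>
      \<kappa>' * t powr (real DIM('a) - d\<^sub>H) \<le> measure lborel (inner_nbhd \<Omega> (frontier \<Omega> \<inter> ball x s) t) \<and>
      measure lborel (inner_nbhd \<Omega> (frontier \<Omega> \<inter> ball x s) t) \<le> \<kappa> * t powr (real DIM('a) - d\<^sub>H)"
      unfolding P_def eventually_at_right_field by simp
  qed
qed

text \<open>The codimension decides: a negative one contradicts the volume bounds, zero forces a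
  boundary of positive measure, and a positive one gives a null boundary piece to which the shell
  argument applies.\<close>

lemma hardy_ahlfors_bound:
  fixes \<Omega> :: "'a::euclidean_space set"
  assumes \<Omega>: "open \<Omega>" and ahlfors: "ahlfors_point \<Omega> x d\<^sub>H"
    and hardy: "weighted_hardy \<Omega> \<delta> r a" and a: "0 < a" and r: "0 < r"
  shows "2 \<le> a * \<bar>(real DIM('a) - d\<^sub>H) + \<delta> - 2\<bar>"
proof -
  define D where "D = real DIM('a) - d\<^sub>H"
  have x: "x \<in> frontier \<Omega>" using ahlfors by (simp add: ahlfors_point_def)
  then have fr: "frontier \<Omega> \<noteq> {}" by blast
  define A where "A s t = inner_nbhd \<Omega> (frontier \<Omega> \<inter> ball x s) t" for s t
  have A_meas: "A s t \<in> fmeasurable lborel" if "s > 0" for s t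
    unfolding A_def by (rule inner_nbhd_fmeasurable) (use x that in auto)
  have A_mono: "measure lborel (A s t) \<le> measure lborel (A s t')" if "s > 0" "t \<le> t'" for s t t'
    by (rule fmeasurable_measure_mono[OF A_meas A_meas]) (use that in \<open>auto simp: A_def inner_nbhd_def\<close>)
  obtain s\<^sub>0 where s0: "0 < s\<^sub>0" "\<And>s. 0 < s \<Longrightarrow> s < s\<^sub>0 \<Longrightarrow>
      \<exists>\<kappa>>0. \<exists>\<kappa>'>0. \<exists>t\<^sub>0>0. \<forall>t. 0 < t \<longrightarrow> t < t\<^sub>0 \<longrightarrow>
      \<kappa>' * t powr D \<le> measure lborel (A s t) \<and> measure lborel (A s t) \<le> \<kappa> * t powr D"
    using ahlfors_pointE[OF ahlfors] unfolding D_def A_def by blast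
  \<comment> \<open>Since \<open>x\<close> is a boundary point, \<open>s < r\<close> keeps the part
    of \<Omega> near \<open>x\<close> inside the layer.\<close>
  define s where "s = min s\<^sub>0 r / 2"
  have s: "0 < s" "s < s\<^sub>0" "s < r" using s0(1) r by (auto simp: s_def)
  obtain \<kappa> \<kappa>1 t1 where up: "\<kappa> > 0" "\<kappa>1 > 0" "t1 > 0"
    "\<And>t. 0 < t \<Longrightarrow> t < t1 \<Longrightarrow> \<kappa>1 * t powr D \<le> measure lborel (A s t)"
    "\<And>t. 0 < t \<Longrightarrow> t < t1 \<Longrightarrow> measure lborel (A s t) \<le> \<kappa> * t powr D"
    using s0(2)[OF s(1,2)] by blast
  obtain \<kappa>' t2 where lo: "\<kappa>' > 0" "t2 > 0"
    "\<And>t. 0 < t \<Longrightarrow> t < t2 \<Longrightarrow> \<kappa>' * t powr D \<le> measure lborel (A (s / 4) t)"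
    using s0(2)[of "s / 4"] s by auto
  have "D \<ge> 0"
  proof (rule ccontr)
    assume "\<not> D \<ge> 0"
    define V where "V = measure lborel (A s t1)"
    have V: "V \<ge> 0" by (simp add: V_def)
    \<comment> \<open>For negative \<open>D\<close> the lower volume bound blows up as the radius
      shrinks; at \<open>u\<close> it already exceeds \<open>V\<close>, the volume of a larger
      neighbourhood.\<close>
    define u where "u = min (t1 / 2) (((V + 1) / \<kappa>1) powr (1 / D))"
    have u: "0 < u" "u < t1" using up V by (auto simp: u_def min_less_iff_disj)
    have "(V + 1) / \<kappa>1 = (((V + 1) / \<kappa>1) powr (1 / D)) powr D"
      using V up \<open>\<not> D \<ge> 0\<close> by (simp add: powr_powr)
    also have "\<dots> \<le> u powr D" using u \<open>\<not> D \<ge> 0\<close> by (intro powr_mono2') (auto simp: u_def)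
    finally have "V + 1 \<le> \<kappa>1 * u powr D" using up by (simp add: field_simps)
    also have "\<dots> \<le> V" using up(4)[OF u] A_mono[of s u t1] s u by (simp add: V_def)
    finally show False by simp
  qed
  then consider "D = 0" | "D > 0" by linarith
  then have "2 \<le> a * \<bar>D + \<delta> - 2\<bar>"
  proof cases
    case 1
    define E where "E = closure (frontier \<Omega> \<inter> ball x s)"
    have E: "compact E" unfolding E_def compact_closure by (simp add: bounded_Int)
    have "E \<subseteq> frontier \<Omega>" unfolding E_def by (rule closure_minimal) auto
    have "E \<noteq> {}" using x s by (auto simp: E_def)
    \<comment> \<open>With \<open>D = 0\<close> the lower bound is the constant \<kappa>1 for all
      small radii, and it passes to the limit of the neighbourhoods.\<close>
    have "\<kappa>1 \<le> measure lborel E"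
    proof (rule LIMSEQ_le_const[OF measure_infdist_less_tendsto[OF E \<open>E \<noteq> {}\<close>]])
      obtain n0 where n0: "1 / real (Suc n0) < t1" using nat_approx_posE up(3) by blast
      have "\<kappa>1 \<le> measure lborel {y. infdist y E < 1 / real (Suc n)}" if "n \<ge> n0" for n
      proof -
        have n: "0 < 1 / real (Suc n)" "1 / real (Suc n) < t1"
          using n0 that by (auto elim!: le_less_trans[rotated] simp: frac_le)
        have "\<kappa>1 \<le> measure lborel (A s (1 / real (Suc n)))" using up(4)[OF n] 1 n by simp
        also have "\<dots> \<le> measure lborel {y. infdist y E < 1 / real (Suc n)}"
        proof (rule fmeasurable_measure_mono[OF A_meas[OF s(1)]])
          show "A s (1 / real (Suc n)) \<subseteq> {y. infdist y E < 1 / real (Suc n)}"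
          proof
            fix y assume "y \<in> A s (1 / real (Suc n))"
            moreover have "infdist y E \<le> infdist y (frontier \<Omega> \<inter> ball x s)"
              unfolding E_def by (rule infdist_mono[OF closure_subset]) (use x s in auto)
            ultimately show "y \<in> {y. infdist y E < 1 / real (Suc n)}"
              by (auto simp: A_def inner_nbhd_def)
          qed
          show "{y. infdist y E < 1 / real (Suc n)} \<in> fmeasurable lborel"
            by (rule infdist_less_fmeasurable[OF compact_imp_bounded[OF E] \<open>E \<noteq> {}\<close>])
        qed
        finally show ?thesis .
      qed
      then show "\<exists>N. \<forall>n\<ge>N. \<kappa>1 \<le> measure lborel {y. infdist y E < 1 / real (Suc n)}" by blast
    qed
    then have "measure lborel E > 0" using up by linarith
    from hardy_fat_boundary[OF \<Omega> E \<open>E \<subseteq> frontier \<Omega>\<close> this hardy a r] show ?thesis using 1 by simp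
  next
    case 2
    define F where "F = frontier \<Omega> \<inter> ball x s"
    define t0 where "t0 = min (min t1 t2) (s / 4)"
    have t0: "t0 > 0" "t0 \<le> t1" "t0 \<le> t2" "t0 \<le> s / 4" using up lo s by (auto simp: t0_def)
    have F_meas: "F \<in> fmeasurable lborel" unfolding F_def
      by (rule bounded_borel_fmeasurable) (auto intro: bounded_Int)
    \<comment> \<open>\<open>F\<close> lies in all its neighbourhoods, whose volume tends to 0 for
      \<open>D > 0\<close>.\<close>
    have F_null: "measure lborel F = 0"
    proof -
      have "measure lborel F \<le> \<kappa> * t powr D" if "0 < t" "t < t1" for t
      proof -
        have "measure lborel F \<le> measure lborel (A s t)"
          by (rule fmeasurable_measure_mono[OF F_meas A_meas[OF s(1)]])
            (use that in \<open>auto simp: F_def A_def inner_nbhd_def frontier_def\<close>)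
        then show ?thesis using up(5)[OF that] by linarith
      qed
      then have "\<forall>\<^sub>F t in at_right 0. measure lborel F \<le> \<kappa> * t powr D"
        unfolding eventually_at_right_field using up(3) by auto
      moreover have "((\<lambda>t. \<kappa> * t powr D) \<longlongrightarrow> \<kappa> * 0 powr D) (at_right 0)"
      proof (intro tendsto_mult_left tendsto_powr'[OF tendsto_ident_at tendsto_const])
        have "\<forall>\<^sub>F t in at_right 0. 0 \<le> (t::real)"
          by (auto simp: eventually_at_right_field intro: exI[of _ 1])
        then show "(0::real) \<noteq> 0 \<or> 0 < D \<and> (\<forall>\<^sub>F t in at_right 0. 0 \<le> (t::real))" using 2 by simp
      qed
      ultimately have "measure lborel F \<le> \<kappa> * 0 powr D"
        by (intro tendsto_lowerbound) auto
      then show ?thesis by (simp add: measure_nonneg antisym)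
    qed
    have meas: "{y \<in> \<Omega> \<inter> ball x R. dist_bdry \<Omega> y < t} \<in> fmeasurable lborel" for R t
      by (rule dist_layer_fmeasurable[OF \<Omega>]) measurable
    \<comment> \<open>The radii \<open>s / 4\<close>, \<open>s / 2\<close>, \<open>3 * s / 4\<close>
      and \<open>s\<close> leave room \<open>s / 4 \<ge> t0\<close> on both sides: a point within
      \<open>t\<close> of the boundary piece of radius \<open>s / 4\<close> stays in the ball of
      radius \<open>s / 2\<close>, and boundary points within \<open>t\<close> of the ball of radius
      \<open>3 * s / 4\<close> stay in that of radius \<open>s\<close>.\<close>
    show ?thesis
    proof (rule hardy_thin_boundary[OF \<Omega> fr hardy a 2, where x = x and ?R1.0 = "s / 2" and ?R2.0 = "3 * s / 4"])
      show "dist_bdry \<Omega> y < r" if "y \<in> \<Omega> \<inter> cball x (3 * s / 4)" for y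
        using infdist_le[OF x, of y] that s by (auto simp: dist_commute)
    next
      fix t assume t: "0 < t" "t < t0"
      \<comment> \<open>The neighbourhoods are taken in the closure of \<Omega>; their boundary
        points fall into the null set \<open>F\<close>.\<close>
      have "A (s / 4) t \<subseteq> {y \<in> \<Omega> \<inter> ball x (s / 2). dist_bdry \<Omega> y < t} \<union> F"
      proof
        fix y assume "y \<in> A (s / 4) t"
        then have y: "y \<in> closure \<Omega>" "infdist y (frontier \<Omega> \<inter> ball x (s / 4)) < t"
          by (auto simp: A_def inner_nbhd_def)
        have "frontier \<Omega> \<inter> ball x (s / 4) \<noteq> {}" using x s by auto
        from infdist_lessE[OF this y(2)] obtain p
          where p: "p \<in> frontier \<Omega>" "dist x p < s / 4" "dist y p < t" by auto
        have "dist x y < s / 2" using dist_triangle[of x y p] p t t0 by (simp add: dist_commute)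
        moreover have "dist_bdry \<Omega> y < t" using infdist_le[OF p(1), of y] p(3) by simp
        ultimately show "y \<in> {y \<in> \<Omega> \<inter> ball x (s / 2). dist_bdry \<Omega> y < t} \<union> F"
          using y(1) \<Omega> s by (auto simp: F_def frontier_def interior_open)
      qed
      then have "measure lborel (A (s / 4) t) \<le> measure lborel ({y \<in> \<Omega> \<inter> ball x (s / 2). dist_bdry \<Omega> y < t} \<union> F)"
        using s by (intro fmeasurable_measure_mono A_meas fmeasurable.Un meas F_meas) auto
      also have "\<dots> \<le> measure lborel {y \<in> \<Omega> \<inter> ball x (s / 2). dist_bdry \<Omega> y < t} + measure lborel F"
        by (intro measure_Un_le fmeasurableD meas F_meas)
      finally show "\<kappa>' * t powr D \<le> measure lborel {y \<in> \<Omega> \<inter> ball x (s / 2). dist_bdry \<Omega> y < t}"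
        using lo(3)[of t] t t0 F_null by simp
    next
      fix t assume t: "0 < t" "t < t0"
      have "{y \<in> \<Omega> \<inter> ball x (3 * s / 4). dist_bdry \<Omega> y < t} \<subseteq> A s t"
      proof
        fix y assume "y \<in> {y \<in> \<Omega> \<inter> ball x (3 * s / 4). dist_bdry \<Omega> y < t}"
        then have y: "y \<in> \<Omega>" "dist x y < 3 * s / 4" "dist_bdry \<Omega> y < t" by auto
        from infdist_lessE[OF fr y(3)] obtain p where p: "p \<in> frontier \<Omega>" "dist y p < t" by auto
        have "dist x p < s" using dist_triangle[of x p y] p y t t0 by simp
        then have "infdist y (frontier \<Omega> \<inter> ball x s) < t"
          using infdist_le[of p "frontier \<Omega> \<inter> ball x s" y] p by auto
        then show "y \<in> A s t" using y(1) closure_subset[of \<Omega>] by (auto simp: A_def inner_nbhd_def)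
      qed
      then have "measure lborel {y \<in> \<Omega> \<inter> ball x (3 * s / 4). dist_bdry \<Omega> y < t} \<le> measure lborel (A s t)"
        by (intro fmeasurable_measure_mono A_meas meas s(1))
      then show "measure lborel {y \<in> \<Omega> \<inter> ball x (3 * s / 4). dist_bdry \<Omega> y < t} \<le> \<kappa> * t powr D"
        using up(5)[of t] t t0 by simp
    qed (use s up lo t0 in auto)
  qed
  then show ?thesis by (simp add: D_def)
qed

text \<open>Both infima are bounded below as soon as every admissible \<open>a\<close> on every
  layer is; a layer without admissible constant contributes infinity. The excluded \<delta> is the
  one at which the denominator vanishes.\<close>

theorem corollary3p5:
  fixes \<Omega> :: "'a::euclidean_space set" and \<delta> d\<^sub>H :: real and x :: 'a
  assumes "open \<Omega>" and "connected \<Omega>" and "\<Omega> \<noteq> {}" and "frontier \<Omega> \<noteq> {}"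
    and "\<delta> \<ge> 0"
    and "\<forall>\<^sub>F r in at_right 0. \<exists>a>0. weighted_hardy \<Omega> \<delta> r a"
    and "ahlfors_point \<Omega> x d\<^sub>H"
    and "\<delta> \<noteq> 2 - (real DIM('a) - d\<^sub>H)"
  shows "hardy_const_bdry \<Omega> \<delta> \<ge> ereal (2 / \<bar>(real DIM('a) - d\<^sub>H) + \<delta> - 2\<bar>)"
  unfolding hardy_const_bdry_def hardy_const_layer_def
proof (intro INF_greatest)
  fix r a :: real
  assume "r \<in> {0<..}" "a \<in> {a. a > 0 \<and> weighted_hardy \<Omega> \<delta> r a}"
  then have "2 \<le> a * \<bar>(real DIM('a) - d\<^sub>H) + \<delta> - 2\<bar>"
    using hardy_ahlfors_bound[OF assms(1,7)] by auto
  then show "ereal (2 / \<bar>(real DIM('a) - d\<^sub>H) + \<delta> - 2\<bar>) \<le> ereal a"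
    using assms(8) by (simp add: divide_le_eq)
qed

end
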